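(* Let $r\geqslant 3$ be an integer. For any positive integer $t$, there exists a constant $c'_{r,t}$, depending on $r$ and $t$, such that if $s\geqslant c'_{r,t}$ is an integer, $a=1$, and $b$ is a positive integer with $b<t$, then $$\mathrm{ex}_{r}(n,K_{a,b}^{(r)},K_{s,t}^{(r)})=\Theta\left(n^{a+b(r-1)-\frac{ab}{t}}\right)$$ as $n\to\infty$.
   Context: An $r$-graph is an $r$-uniform hypergraph. An $r$-graph is $\mathcal{H}$-free if it contains no copy of the $r$-graph $\mathcal{H}$ as a (not necessarily induced) subhypergraph. For $r$-graphs $\mathcal{T}$ and $\mathcal{H}$, $\mathrm{ex}_{r}(n,\mathcal{T},\mathcal{H})$ is the maximum number of copies of $\mathcal{T}$ in an $n$-vertex $\mathcal{H}$-free $r$-graph. For positive integers $s,t$, the complete bipartite $r$-graph $K_{s,t}^{(r)}$ is defined as follows: let $X_{1},\ldots,X_{t}$ be $t$ pairwise disjoint sets of size $r-1$, and let $Y$ be a set of $s$ elements disjoint from $\bigcup_{i=1}^{t}X_{i}$. Then $K_{s,t}^{(r)}$ has vertex set $\left(\bigcup_{i=1}^{t}X_{i}\right)\cup Y$ and edge set $\{X_{i}\cup\{y\}: 1\leqslant i\leqslant t,\ y\in Y\}$. The same convention applies to $K_{a,b}^{(r)}$: the first index is the size of the set $Y$ of single vertices, and the second index is the number of $(r-1)$-sets. Asymptotic notation is for $n\to\infty$ with $r,s,t,a,b$ fixed; the implied constants are positive and do not depend on $n$. *)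

theory Defs
  imports "HOL-Library.Landau_Symbols"
begin

datatype 'a hypergraph = Hypergraph (verts: "'a set") (edges: "'a set set")

definition r_graph :: "nat \<Rightarrow> 'a hypergraph \<Rightarrow> bool" where
  "r_graph r G \<longleftrightarrow> finite (verts G) \<and> (\<forall>e\<in>edges G. e \<subseteq> verts G \<and> card e = r)"

definition isomorphic :: "'a hypergraph \<Rightarrow> 'b hypergraph \<Rightarrow> bool" where
  "isomorphic G H \<longleftrightarrow>
     (\<exists>f. bij_betw f (verts G) (verts H) \<and> edges H = (\<lambda>e. f ` e) ` edges G)"

definition subhypergraph :: "'a hypergraph \<Rightarrow> 'a hypergraph \<Rightarrow> bool" where
  "subhypergraph S G \<longleftrightarrow>
     verts S \<subseteq> verts G \<and> edges S \<subseteq> edges G \<and> (\<forall>e\<in>edges S. e \<subseteq> verts S)"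

text \<open>Copies are (not necessarily induced) subhypergraphs, so they are unlabelled: embeddings
  differing by an automorphism of the copied hypergraph give the same copy.\<close>

definition copies :: "'b hypergraph \<Rightarrow> 'a hypergraph \<Rightarrow> 'a hypergraph set" where
  "copies T G = {S. subhypergraph S G \<and> isomorphic T S}"

definition free_of :: "'b hypergraph \<Rightarrow> 'a hypergraph \<Rightarrow> bool" where
  "free_of H G \<longleftrightarrow> copies H G = {}"

text \<open>Every finite hypergraph is isomorphic to one with vertices in \<open>nat\<close>, so it suffices to let
  the host hypergraph range over those.\<close>

definition ex_count :: "nat \<Rightarrow> nat \<Rightarrow> 'b hypergraph \<Rightarrow> 'c hypergraph \<Rightarrow> nat" where
  "ex_count r n T H =
     Max {card (copies T G) | G :: nat hypergraph.
            r_graph r G \<and> card (verts G) = n \<and> free_of H G}"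

text \<open>The sum type keeps the single vertices apart from the sets \<open>block r i\<close> (the \<open>X\<^sub>i\<close>), which are
  themselves pairwise disjoint of size \<open>r - 1\<close>; indices start at 0.  The first
  index \<open>s\<close> counts the single vertices (the set \<open>Y\<close>), the second index \<open>t\<close> the blocks.\<close>

definition block :: "nat \<Rightarrow> nat \<Rightarrow> ((nat \<times> nat) + nat) set" where
  "block r i = {Inl (i, j) | j. j < r - 1}"

definition complete_bipartite :: "nat \<Rightarrow> nat \<Rightarrow> nat \<Rightarrow> ((nat \<times> nat) + nat) hypergraph" where
  "complete_bipartite r s t =
     Hypergraph ((\<Union>i<t. block r i) \<union> Inr ` {..<s})
       {block r i \<union> {Inr y} | i y. i < t \<and> y < s}"

lemma card_block: "card (block r i) = r - 1"
proof -
  have "block r i = (\<lambda>j. Inl (i, j)) ` {..<r - 1}"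
    by (auto simp: block_def)
  then show ?thesis
    by (simp add: card_image inj_on_def)
qed

lemma finite_block: "finite (block r i)"
  by (simp add: block_def)

lemma r_graph_complete_bipartite:
  assumes "r \<ge> 1"
  shows "r_graph r (complete_bipartite r s t)"
proof -
  have "card (block r i \<union> {Inr y}) = r" for i y
  proof -
    have "Inr y \<notin> block r i" by (auto simp: block_def)
    then show ?thesis using assms by (simp add: finite_block card_block)
  qed
  then show ?thesis
    by (auto simp: r_graph_def complete_bipartite_def finite_block)
qed

text \<open>The maximum defining \<open>ex_count\<close> is over a finite set, nonempty as soon as the forbidden
  hypergraph has an edge.\<close>

lemma card_copies_le:
  fixes G :: "'a hypergraph"
  assumes "r_graph r G"
  shows "finite (copies T G)"
    and "card (copies T G) \<le> 2 ^ card (verts G) * 2 ^ (2 ^ card (verts G))"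
proof -
  let ?B = "case_prod Hypergraph ` (Pow (verts G) \<times> Pow (Pow (verts G)))"
  have fin: "finite (verts G)" using assms by (simp add: r_graph_def)
  have sub: "copies T G \<subseteq> ?B"
  proof
    fix S assume "S \<in> copies T G"
    then have "verts S \<subseteq> verts G" "edges S \<subseteq> Pow (verts G)"
      using assms by (auto simp: copies_def subhypergraph_def r_graph_def)
    then show "S \<in> ?B"
      by (intro image_eqI[of _ _ "(verts S, edges S)"]) auto
  qed
  show "finite (copies T G)" by (rule finite_subset[OF sub]) (use fin in simp)
  have "card (copies T G) \<le> card ?B" using sub fin by (intro card_mono) auto
  also have "\<dots> \<le> card (Pow (verts G) \<times> Pow (Pow (verts G)))"
    using fin by (intro card_image_le) auto
  finally show "card (copies T G) \<le> 2 ^ card (verts G) * 2 ^ (2 ^ card (verts G))"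
    using fin by (simp add: card_cartesian_product card_Pow)
qed

lemma ex_count_set_finite:
  "finite {card (copies T G) | G :: nat hypergraph.
            r_graph r G \<and> card (verts G) = n \<and> free_of H G}"
  by (rule finite_subset[of _ "{..2 ^ n * 2 ^ (2 ^ n)}"]) (use card_copies_le(2) in auto)

lemma ex_count_set_nonempty:
  assumes "edges H \<noteq> {}"
  shows "{card (copies T G) | G :: nat hypergraph.
            r_graph r G \<and> card (verts G) = n \<and> free_of H G} \<noteq> {}"
proof -
  let ?G = "Hypergraph {..<n} {}"
  have "r_graph r ?G" "card (verts ?G) = n" "free_of H ?G"
    using assms by (auto simp: r_graph_def free_of_def copies_def subhypergraph_def isomorphic_def)
  then show ?thesis by blast
qed

end

theory Submission
  imports Defs "HOL-Algebra.Algebraic_Closure_Type" "HOL-Library.Z2" "HOL-Library.Function_Algebras"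
begin

text \<open>Both bounds compare the number of stars with the degrees \<open>D\<^sub>y\<close> of the links, where
  vertices with \<open>D\<^sub>y\<close> up to the order of \<open>n\<close> to the \<open>r - 1 - 1/t\<close> contribute at most the
  claimed order, and the other links are so large that a positive proportion of their tuples is
  pairwise disjoint. For
  the upper bound, a disjoint \<open>t\<close>-tuple lies in fewer than \<open>s\<close> links, which bounds the sum of the
  \<open>t\<close>-th powers of the degrees. The lower bound needs a \<open>K\<^sub>s\<^sub>,\<^sub>t\<close>-free hypergraph with
  many edges.

  Let \<open>q\<close> be a power of two, \<open>Q = q ^ t\<close>, \<open>L\<close> the field of order \<open>Q\<close> and \<open>K\<close> its extension
  of degree \<open>r\<close> with \<open>L\<close>-basis \<open>\<omega>\<close>. An \<open>r\<close>-tuple \<open>x\<close> over \<open>L\<close> is an edge if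
  the norm of \<open>\<Sum>i. \<omega> i * x i\<close> down to the field of order \<open>q\<close> is a fixed constant. Fixing all
  coordinates but the \<open>j\<close>-th, this says that the norm of \<open>y + \<theta>\<close> is constant, where \<open>\<theta> \<in> K\<close>
  determines the fixed coordinates. Writing \<open>u j = y ^ (q ^ j)\<close>, the norm is a product of \<open>t\<close>
  polynomials of degree \<open>r\<close>, one in each \<open>u j\<close>, whose roots are conjugates of \<open>- \<theta>\<close> over \<open>L\<close>.
  If \<open>t\<close> values of \<open>\<theta>\<close> are pairwise not conjugate, these polynomials are pairwise coprime and the
  \<open>t\<close> equations have at most \<open>(t * r) ^ t\<close> common solutions. Conjugate values are excluded by
  colouring \<open>K\<close> with \<open>r\<close> colours so that distinct conjugates get distinct colours, and keeping
  the edges of the most popular colour pattern.\<close>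

section \<open>Systems of products of univariate polynomials\<close>

text \<open>Multiply the two identities: every term of the product except the one with
  \<open>g * h\<close> contains \<open>f\<close>. Coprimality is kept as an explicit identity
  because partial fractions use its coefficients.\<close>

lemma bezout_mult:
  fixes f g h :: "'a::comm_ring_1"
  assumes "\<exists>u v. u * f + v * g = 1" and "\<exists>u v. u * f + v * h = 1"
  shows "\<exists>u v. u * f + v * (g * h) = 1"
proof -
  obtain u v where 1: "u * f + v * g = 1" using assms(1) by blast
  obtain u' v' where 2: "u' * f + v' * h = 1" using assms(2) by blast
  have "(u * f + v * g) * (u' * f + v' * h) = 1" using 1 2 by simp
  then have "(u * u' * f + u * v' * h + v * u' * g) * f + (v * v') * (g * h) = 1"
    by (simp add: algebra_simps)
  then show ?thesis by blast
qed

lemma bezout_prod: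
  fixes f :: "'a::comm_ring_1"
  assumes "finite I" and "\<And>i. i \<in> I \<Longrightarrow> \<exists>u v. u * f + v * g i = 1"
  shows "\<exists>u v. u * f + v * (\<Prod>i\<in>I. g i) = 1"
  using assms
proof (induction I)
  case empty
  have "0 * f + 1 * (\<Prod>i\<in>{}. g i) = 1" by simp
  then show ?case by blast
next
  case (insert i I)
  then show ?case using bezout_mult[of f "g i" "\<Prod>i\<in>I. g i"] by simp
qed

lemma bezout_sym:
  fixes f g :: "'a::comm_ring_1"
  shows "\<exists>u v. u * f + v * g = 1 \<Longrightarrow> \<exists>u v. u * g + v * f = 1"
  by (metis add.commute)

text \<open>Two distinct monic linear polynomials differ by a nonzero constant, which settles single
  factors; products are reached by applying \<open>bezout_prod\<close> on each side.\<close>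

lemma bezout_prod_linear:
  fixes \<alpha> :: "'b \<Rightarrow> 'a::field"
  assumes "finite I" "finite J" and ne: "\<And>i j. i \<in> I \<Longrightarrow> j \<in> J \<Longrightarrow> \<alpha> i \<noteq> \<beta> j"
  shows "\<exists>u v. u * (\<Prod>i\<in>I. [:\<alpha> i, 1:]) + v * (\<Prod>j\<in>J. [:\<beta> j, 1:]) = 1"
proof -
  have lin: "\<exists>u v. u * [:\<alpha> i, 1:] + v * [:\<beta> j, 1:] = 1" if "i \<in> I" "j \<in> J" for i j
  proof -
    have "\<alpha> i - \<beta> j \<noteq> 0" using ne[OF that] by simp
    then have "[:1 / (\<alpha> i - \<beta> j):] * [:\<alpha> i, 1:] + [:- 1 / (\<alpha> i - \<beta> j):] * [:\<beta> j, 1:] = 1"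
      by (simp add: one_pCons diff_divide_distrib[symmetric])
    then show ?thesis by blast
  qed
  have "\<exists>u v. u * (\<Prod>j\<in>J. [:\<beta> j, 1:]) + v * [:\<alpha> i, 1:] = 1" if "i \<in> I" for i
    by (intro bezout_sym[OF bezout_prod[OF assms(2)]] lin that)
  then show ?thesis
    by (intro bezout_sym[OF bezout_prod[OF assms(1)]])
qed

text \<open>In the induction, \<open>u * f k + v * (\<Prod>l\<in>I. f l) = 1\<close> is combined
  with the identity for \<open>I\<close> scaled by \<open>u * f k\<close>.\<close>

lemma bezout_family:
  fixes f :: "'i \<Rightarrow> 'a::comm_ring_1"
  assumes "finite I" "I \<noteq> {}"
    and "\<And>i j. i \<in> I \<Longrightarrow> j \<in> I \<Longrightarrow> i \<noteq> j \<Longrightarrow> \<exists>u v. u * f i + v * f j = 1"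
  shows "\<exists>a. (\<Sum>i\<in>I. a i * (\<Prod>l\<in>I - {i}. f l)) = 1"
  using assms
proof (induction I rule: finite_ne_induct)
  case (singleton x)
  have "(\<Sum>i\<in>{x}. 1 * (\<Prod>l\<in>{x} - {i}. f l)) = 1" by simp
  then show ?case by (intro exI[of _ "\<lambda>_. 1"])
next
  case (insert k I)
  then obtain a where a: "(\<Sum>i\<in>I. a i * (\<Prod>l\<in>I - {i}. f l)) = 1" by auto
  have "\<exists>u v. u * f k + v * (\<Prod>l\<in>I. f l) = 1"
    using insert by (intro bezout_prod) auto
  then obtain u v where uv: "u * f k + v * (\<Prod>l\<in>I. f l) = 1" by blast
  define a' where "a' = (\<lambda>i. if i = k then v else u * a i)"
  have "(\<Sum>i\<in>insert k I. a' i * (\<Prod>l\<in>insert k I - {i}. f l))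
      = v * (\<Prod>l\<in>insert k I - {k}. f l) + (\<Sum>i\<in>I. a' i * (\<Prod>l\<in>insert k I - {i}. f l))"
    using insert by (simp add: a'_def)
  also have "insert k I - {k} = I" using insert by auto
  also have "(\<Sum>i\<in>I. a' i * (\<Prod>l\<in>insert k I - {i}. f l)) = (\<Sum>i\<in>I. u * f k * (a i * (\<Prod>l\<in>I - {i}. f l)))"
  proof (rule sum.cong)
    fix i assume i: "i \<in> I"
    then have "insert k I - {i} = insert k (I - {i})" "i \<noteq> k" using insert by auto
    then show "a' i * (\<Prod>l\<in>insert k I - {i}. f l) = u * f k * (a i * (\<Prod>l\<in>I - {i}. f l))"
      using insert by (simp add: a'_def mult_ac)
  qed simp
  also have "\<dots> = u * f k" by (simp add: sum_distrib_left[symmetric] a)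
  finally show ?case using uv by (intro exI[of _ a']) (simp add: add.commute)
qed

section \<open>Partial fractions with monic denominators\<close>

lemma degree_monic_prod:
  fixes f :: "'i \<Rightarrow> 'a::field poly"
  assumes "finite I" "\<And>i. i \<in> I \<Longrightarrow> degree (f i) = d \<and> lead_coeff (f i) = 1"
  shows "degree (\<Prod>i\<in>I. f i) = card I * d" "lead_coeff (\<Prod>i\<in>I. f i) = 1"
proof -
  have "f i \<noteq> 0" if "i \<in> I" for i using assms(2)[OF that] by auto
  then show "degree (\<Prod>i\<in>I. f i) = card I * d"
    using assms by (subst degree_prod_eq_sum_degree) auto
  show "lead_coeff (\<Prod>i\<in>I. f i) = 1"
    unfolding lead_coeff_prod by (rule prod.neutral) (use assms(2) in blast)
qed

text \<open>Multiplying \<open>bezout_family\<close> by \<open>p\<close> gives such a sum without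
  degree control; the coefficients are then reduced modulo \<open>f i\<close>. The collected
  quotients form a multiple of the product of all \<open>f i\<close>, and comparing degrees shows
  that it is zero.\<close>

lemma partial_fraction_poly:
  fixes f :: "'i \<Rightarrow> 'a::field poly"
  assumes "finite I" "I \<noteq> {}" "d > 0"
    and monic: "\<And>i. i \<in> I \<Longrightarrow> degree (f i) = d \<and> lead_coeff (f i) = 1"
    and bez: "\<And>i j. i \<in> I \<Longrightarrow> j \<in> I \<Longrightarrow> i \<noteq> j \<Longrightarrow> \<exists>u v. u * f i + v * f j = 1"
    and deg: "degree p < card I * d"
  shows "\<exists>h. (\<forall>i\<in>I. degree (h i) < d) \<and> p = (\<Sum>i\<in>I. h i * (\<Prod>l\<in>I - {i}. f l))"
proof -
  obtain a where a: "(\<Sum>i\<in>I. a i * (\<Prod>l\<in>I - {i}. f l)) = 1"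
    using bezout_family[of I f] assms(1,2) bez by blast
  define h where "h i = (p * a i) mod f i" for i
  define F where "F = (\<Prod>i\<in>I. f i)"
  have F: "degree F = card I * d" "F \<noteq> 0"
    using degree_monic_prod[of I f d] assms(1) monic unfolding F_def by force+
  have dh: "degree (h i) < d" if "i \<in> I" for i
    using monic[OF that] assms(3) degree_mod_less[of "f i" "p * a i"]
    by (cases "f i = 0") (auto simp: h_def)
  define S where "S = (\<Sum>i\<in>I. h i * (\<Prod>l\<in>I - {i}. f l))"
  have "p = (\<Sum>i\<in>I. p * a i * (\<Prod>l\<in>I - {i}. f l))"
    using a by (simp add: sum_distrib_left[symmetric] mult.assoc)
  also have "\<dots> = (\<Sum>i\<in>I. h i * (\<Prod>l\<in>I - {i}. f l) + ((p * a i) div f i) * F)"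
  proof (rule sum.cong)
    fix i assume i: "i \<in> I"
    have "F = f i * (\<Prod>l\<in>I - {i}. f l)" using assms(1) i by (simp add: F_def prod.remove)
    moreover have "p * a i = h i + ((p * a i) div f i) * f i"
      by (simp add: h_def)
    ultimately show "p * a i * (\<Prod>l\<in>I - {i}. f l) = h i * (\<Prod>l\<in>I - {i}. f l) + ((p * a i) div f i) * F"
      by (metis distrib_right mult.assoc)
  qed simp
  also have "\<dots> = S + (\<Sum>i\<in>I. (p * a i) div f i) * F"
    by (simp add: sum.distrib S_def sum_distrib_right)
  finally have eq: "p = S + (\<Sum>i\<in>I. (p * a i) div f i) * F" .
  have "degree S < card I * d"
    unfolding S_def
  proof (rule degree_sum_less)
    fix i assume i: "i \<in> I"
    have "degree (\<Prod>l\<in>I - {i}. f l) = (card I - 1) * d"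
      using degree_monic_prod(1)[of "I - {i}" f d, OF _ monic] assms(1) i by simp
    then have "degree (h i * (\<Prod>l\<in>I - {i}. f l)) < d + (card I - 1) * d"
      using degree_mult_le[of "h i" "\<Prod>l\<in>I - {i}. f l"] dh[OF i] by linarith
    also have "\<dots> = card I * d"
      using assms(1) i by (cases "card I") auto
    finally show "degree (h i * (\<Prod>l\<in>I - {i}. f l)) < card I * d" .
  qed (use deg in linarith)
  then have "degree (p - S) < card I * d" using deg by (simp add: degree_diff_less)
  moreover have "p - S = (\<Sum>i\<in>I. (p * a i) div f i) * F" using eq by (metis add_diff_cancel_left')
  ultimately have "(\<Sum>i\<in>I. (p * a i) div f i) = 0"
    using F by (metis degree_mult_eq linorder_not_less le_add2)
  then have "p = S" using eq by simp
  then show ?thesis using dh unfolding S_def by blast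
qed

section \<open>Counting solutions by the dimension of a function space\<close>

lemma sum_fun_apply: "(\<Sum>i\<in>I. f i) x = (\<Sum>i\<in>I. f i x)"
  for f :: "'i \<Rightarrow> 'b \<Rightarrow> 'a::comm_monoid_add"
  by (induction I rule: infinite_finite_induct) auto

text \<open>Polynomials of degree less than \<open>t * d\<close> in each variable already span all functions on the
  solution set: a product of \<open>t\<close> factors, one per variable, in which one factor is the full product
  over \<open>i\<close> and each other one omits a single \<open>f i j\<close>, contains \<open>f i j\<close> for all \<open>j\<close> and some
  common \<open>i\<close>, so the \<open>i\<close>-th equation lowers its degree.\<close>

lemma box_bound:
  fixes f :: "nat \<Rightarrow> nat \<Rightarrow> 'a::field poly" and u :: "nat \<Rightarrow> 'b \<Rightarrow> 'a"
  assumes finY: "finite Y" and "t > 0" "d > 0"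
    and monic: "\<And>i j. i < t \<Longrightarrow> j < t \<Longrightarrow> degree (f i j) = d \<and> lead_coeff (f i j) = 1"
    and bez: "\<And>i i' j. i < t \<Longrightarrow> i' < t \<Longrightarrow> j < t \<Longrightarrow> i \<noteq> i' \<Longrightarrow>
                \<exists>a b. a * f i j + b * f i' j = 1"
    and eqs: "\<And>y i. y \<in> Y \<Longrightarrow> i < t \<Longrightarrow> (\<Prod>j<t. poly (f i j) (u j y)) = c i"
    and sep: "\<And>y y'. y \<in> Y \<Longrightarrow> y' \<in> Y \<Longrightarrow> y \<noteq> y' \<Longrightarrow> \<exists>j<t. u j y \<noteq> u j y'"
  shows "card Y \<le> (t * d) ^ t"
proof -
  define D where "D = t * d"
  have D: "card {..<t} * d = D" by (simp add: D_def)
  have Dpos: "D > 0" using assms by (simp add: D_def)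
  \<comment> \<open>Values off \<open>Y\<close> are set to 0, so that linear relations have to hold
    at the solutions only.\<close>
  define N where "N p = (\<lambda>y. if y \<in> Y then \<Prod>j<t. poly (p j) (u j y) else 0)" for p
  define B where "B = (\<lambda>e. N (\<lambda>j. monom 1 (e j))) ` PiE {..<t} (\<lambda>_. {..<D})"
  interpret vs: vector_space "\<lambda>(c::'a) (g::'b \<Rightarrow> 'a) x. c * g x"
    by unfold_locales (auto simp: algebra_simps fun_eq_iff)
  define W where "W = vs.span B"

  \<comment> \<open>Expanding the product of the \<open>t\<close> polynomials gives a linear
    combination of the monomials in \<open>B\<close>.\<close>
  have box: "N p \<in> W" if dp: "\<And>j. j < t \<Longrightarrow> degree (p j) < D" for p
  proof -
    have "N p = (\<Sum>e\<in>PiE {..<t} (\<lambda>_. {..<D}).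
            (\<lambda>y. (\<Prod>j<t. coeff (p j) (e j)) * N (\<lambda>j. monom 1 (e j)) y))"
    proof
      fix y
      show "N p y = (\<Sum>e\<in>PiE {..<t} (\<lambda>_. {..<D}).
            (\<lambda>y. (\<Prod>j<t. coeff (p j) (e j)) * N (\<lambda>j. monom 1 (e j)) y)) y"
      proof (cases "y \<in> Y")
        case True
        have "poly (p j) (u j y) = (\<Sum>k<D. coeff (p j) k * u j y ^ k)" if "j < t" for j
          unfolding poly_altdef
          by (intro sum.mono_neutral_left) (use dp[OF that] in \<open>auto simp: coeff_eq_0\<close>)
        then have "N p y = (\<Prod>j<t. \<Sum>k<D. coeff (p j) k * u j y ^ k)"
          using True by (simp add: N_def)
        also have "\<dots> = (\<Sum>e\<in>PiE {..<t} (\<lambda>_. {..<D}). \<Prod>j<t. coeff (p j) (e j) * u j y ^ e j)"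
          by (rule prod_sum_PiE) auto
        finally show ?thesis using True
          by (simp add: sum_fun_apply N_def prod.distrib poly_monom)
      qed (simp add: N_def sum_fun_apply)
    qed
    also have "\<dots> \<in> W"
      unfolding W_def by (intro vs.span_sum vs.span_scale vs.span_base) (auto simp: B_def)
    finally show ?thesis .
  qed

  \<comment> \<open>The critical degree: the factor at \<open>j0\<close> has degree
    \<open>D\<close>, one too many. Every other factor is expanded in partial fractions, so that
    each summand \<open>T \<sigma>\<close> omits only \<open>f (\<sigma> j) j\<close> at
    \<open>j\<close>, up to a multiplier of degree below \<open>d\<close>.\<close>
  have top: "N (p(j0 := \<Prod>i<t. f i j0)) \<in> W"
    if j0: "j0 < t" and dp: "\<And>j. j < t \<Longrightarrow> j \<noteq> j0 \<Longrightarrow> degree (p j) < D" for p j0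
  proof -
    define J where "J = {..<t} - {j0}"
    have "\<exists>h. (\<forall>i\<in>{..<t}. degree (h i) < d) \<and> p j = (\<Sum>i<t. h i * (\<Prod>l\<in>{..<t} - {i}. f l j))"
      if "j \<in> J" for j
      using that dp[of j] assms(2,3) monic bez
      by (intro partial_fraction_poly) (auto simp: J_def D_def)
    then obtain h where h: "\<And>i j. j \<in> J \<Longrightarrow> i < t \<Longrightarrow> degree (h j i) < d"
      "\<And>j. j \<in> J \<Longrightarrow> p j = (\<Sum>i<t. h j i * (\<Prod>l\<in>{..<t} - {i}. f l j))"
      by (metis lessThan_iff)
    define T where "T \<sigma> = (\<lambda>j. if j = j0 then \<Prod>i<t. f i j0
        else h j (\<sigma> j) * (\<Prod>l\<in>{..<t} - {\<sigma> j}. f l j))" for \<sigma>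
    have split: "(\<Prod>j<t. g j) = g j0 * (\<Prod>j\<in>J. g j)" for g :: "nat \<Rightarrow> 'a"
      using j0 by (simp add: J_def prod.remove)
    have "N (p(j0 := \<Prod>i<t. f i j0)) = (\<Sum>\<sigma>\<in>PiE J (\<lambda>_. {..<t}). N (T \<sigma>))"
    proof
      fix y
      show "N (p(j0 := \<Prod>i<t. f i j0)) y = (\<Sum>\<sigma>\<in>PiE J (\<lambda>_. {..<t}). N (T \<sigma>)) y"
      proof (cases "y \<in> Y")
        case True
        have "N (p(j0 := \<Prod>i<t. f i j0)) y
            = poly (\<Prod>i<t. f i j0) (u j0 y) * (\<Prod>j\<in>J. poly (p j) (u j y))"
          using True by (simp add: N_def split J_def)
        also have "(\<Prod>j\<in>J. poly (p j) (u j y))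
            = (\<Prod>j\<in>J. \<Sum>i<t. poly (h j i * (\<Prod>l\<in>{..<t} - {i}. f l j)) (u j y))"
          by (intro prod.cong) (simp_all add: h(2) poly_sum)
        also have "\<dots> = (\<Sum>\<sigma>\<in>PiE J (\<lambda>_. {..<t}).
            \<Prod>j\<in>J. poly (h j (\<sigma> j) * (\<Prod>l\<in>{..<t} - {\<sigma> j}. f l j)) (u j y))"
          by (rule prod_sum_PiE) (auto simp: J_def)
        also have "\<dots> = (\<Sum>\<sigma>\<in>PiE J (\<lambda>_. {..<t}). \<Prod>j\<in>J. poly (T \<sigma> j) (u j y))"
          by (intro sum.cong prod.cong) (auto simp: T_def J_def)
        finally show ?thesis using True
          by (simp add: sum_fun_apply N_def split sum_distrib_left) (simp add: T_def)
      qed (simp add: N_def sum_fun_apply)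
    qed
    also have "\<dots> \<in> W"
      unfolding W_def
    proof (rule vs.span_sum, fold W_def)
      fix \<sigma> assume \<sigma>: "\<sigma> \<in> PiE J (\<lambda>_. {..<t})"
      \<comment> \<open>The at most \<open>t - 1\<close> values of \<open>\<sigma>\<close> miss some
        \<open>i\<close>, so \<open>f i j\<close> divides the factor of every variable
        \<open>j\<close>.\<close>
      have "card (\<sigma> ` J) \<le> card J" by (rule card_image_le) (simp add: J_def)
      also have "\<dots> < card {..<t}" using j0 by (simp add: J_def)
      finally have "\<not> {..<t} \<subseteq> \<sigma> ` J"
        using card_mono[of "\<sigma> ` J" "{..<t}"] by (auto simp: J_def)
      then obtain i where i: "i < t" "i \<notin> \<sigma> ` J" by auto
      define T' where "T' = (\<lambda>j. if j = j0 then \<Prod>l\<in>{..<t} - {i}. f l j0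
        else h j (\<sigma> j) * (\<Prod>l\<in>{..<t} - {\<sigma> j} - {i}. f l j))"
      have TT': "T \<sigma> j = f i j * T' j" if "j < t" for j
      proof (cases "j = j0")
        case True
        then show ?thesis using i by (simp add: T_def T'_def prod.remove)
      next
        case False
        then have "i \<in> {..<t} - {\<sigma> j}" using i that by (auto simp: J_def)
        then have "(\<Prod>l\<in>{..<t} - {\<sigma> j}. f l j) = f i j * (\<Prod>l\<in>{..<t} - {\<sigma> j} - {i}. f l j)"
          by (simp add: prod.remove)
        then show ?thesis using False by (simp add: T_def T'_def mult_ac)
      qed
      \<comment> \<open>On \<open>Y\<close> the extracted factors multiply to the constant
        \<open>c i\<close>, by the \<open>i\<close>-th equation.\<close>
      have "N (T \<sigma>) = (\<lambda>y. c i * N T' y)"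
        using eqs i by (auto simp: N_def TT' prod.distrib fun_eq_iff)
      moreover have "N T' \<in> W"
      proof (rule box)
        fix j assume j: "j < t"
        have m: "degree (\<Prod>l\<in>A. f l j) = card A * d" if "A \<subseteq> {..<t}" for A
          using that j by (intro degree_monic_prod(1) monic) (auto intro: finite_subset)
        show "degree (T' j) < D"
        proof (cases "j = j0")
          case True
          then show ?thesis using m[of "{..<t} - {i}"] i assms(2,3)
            by (cases t) (simp_all add: T'_def D_def)
        next
          case False
          then have jJ: "j \<in> J" "\<sigma> j < t" using j \<sigma> by (auto simp: J_def)
          then have ne: "i \<noteq> \<sigma> j" using i by auto
          \<comment> \<open>At \<open>j\<close> both \<open>\<sigma> j\<close> and \<open>i\<close>
            are now missing, leaving \<open>t - 2\<close> monic factors of degree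
            \<open>d\<close>.\<close>
          have "card ({..<t} - {\<sigma> j} - {i}) = t - 2"
            using i jJ ne by simp
          then have "degree (T' j) \<le> degree (h j (\<sigma> j)) + (t - 2) * d"
            using False m[OF Diff_subset[THEN order_trans, OF Diff_subset], of "{\<sigma> j}" "{i}"]
              degree_mult_le[of "h j (\<sigma> j)" "\<Prod>l\<in>{..<t} - {\<sigma> j} - {i}. f l j"]
            by (simp add: T'_def)
          also have "\<dots> < d + (t - 2) * d" using h(1)[OF jJ] by simp
          also have "\<dots> \<le> D" using i jJ ne by (cases t) (auto simp: D_def algebra_simps diff_mult_distrib)
          finally show ?thesis .
        qed
      qed
      ultimately show "N (T \<sigma>) \<in> W" unfolding W_def using vs.span_scale by simp
    qed
    finally show ?thesis .
  qed

  \<comment> \<open>Raising the exponent at \<open>j0\<close> leaves the box only if it becomes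
    \<open>D\<close>. Then the power is replaced by the monic product \<open>F\<close> of the same
    degree, handled by \<open>top\<close>, and a remainder of smaller degree.\<close>
  have mult_basis: "(\<lambda>y. u j0 y * g y) \<in> W" if g: "g \<in> B" and j0: "j0 < t" for g j0
  proof -
    obtain e where e: "e \<in> PiE {..<t} (\<lambda>_. {..<D})" "g = N (\<lambda>j. monom 1 (e j))"
      using g by (auto simp: B_def)
    define p where "p = (\<lambda>j. monom (1::'a) (e j))"
    define P where "P = monom (1::'a) (e j0 + 1)"
    have e_less: "e j < D" if "j < t" for j using e(1) that by auto
    have dp: "degree (p j) < D" if "j < t" for j
      using e_less[OF that] by (simp add: p_def degree_monom_eq)
    have eq: "(\<lambda>y. u j0 y * g y) = N (p(j0 := P))"
    proof
      fix y
      have "(\<Prod>j<t. poly ((p(j0 := P)) j) (u j y)) = u j0 y * (\<Prod>j<t. poly (p j) (u j y))"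
        using j0 by (simp add: prod.remove[of "{..<t}" j0] p_def P_def poly_monom)
      then show "u j0 y * g y = N (p(j0 := P)) y"
        by (simp add: N_def e(2) p_def)
    qed
    show ?thesis
    proof (cases "e j0 + 1 < D")
      case True
      then show ?thesis unfolding eq
        using dp by (intro box) (auto simp: P_def degree_monom_eq)
    next
      case False
      then have e0: "e j0 + 1 = D" using e_less[OF j0] by simp
      define F where "F = (\<Prod>i<t. f i j0)"
      have F: "degree F = D" "lead_coeff F = 1"
        using degree_monic_prod[of "{..<t}" "\<lambda>i. f i j0" d, OF _ monic[OF _ j0]]
        unfolding F_def D_def by auto
      have "degree (P - F) < D"
      proof -
        have "degree (P - F) \<le> D"
          unfolding P_def e0 using F(1) by (intro degree_diff_le degree_monom_le) simp
        moreover have "coeff (P - F) D = 0"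
          using F e0 by (simp add: P_def)
        ultimately show ?thesis
          using Dpos by (metis degree_0 leading_coeff_0_iff le_neq_implies_less)
      qed
      then have "N (p(j0 := P - F)) \<in> W"
        using dp by (intro box) auto
      moreover have "N (p(j0 := F)) \<in> W"
        unfolding F_def using dp j0 by (intro top) auto
      moreover have "N (p(j0 := P)) = N (p(j0 := F)) + N (p(j0 := P - F))"
      proof
        fix y
        show "N (p(j0 := P)) y = (N (p(j0 := F)) + N (p(j0 := P - F))) y"
          using j0 by (simp add: N_def prod.remove[of "{..<t}" j0] algebra_simps)
      qed
      ultimately show ?thesis unfolding eq W_def by (simp add: vs.span_add)
    qed
  qed

  have mult: "(\<lambda>y. u j y * g y) \<in> W" if g: "g \<in> W" and j: "j < t" for g j
    using g unfolding W_def
  proof (induction rule: vs.span_induct_alt)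
    case base
    show ?case by (simp add: vs.span_zero[unfolded zero_fun_def] zero_fun_def)
  next
    case (step a x g)
    have "(\<lambda>y. u j y * ((\<lambda>y. a * x y) + g) y) = (\<lambda>y. a * (u j y * x y)) + (\<lambda>y. u j y * g y)"
      by (auto simp: fun_eq_iff algebra_simps)
    then show ?case
      using step mult_basis[OF _ j] vs.span_add vs.span_scale unfolding W_def by simp
  qed
  have mult': "(\<lambda>y. (u j y - a) * g y) \<in> W" if g: "g \<in> W" and j: "j < t" for g j a
  proof -
    have "(\<lambda>y. (u j y - a) * g y) = (\<lambda>y. u j y * g y) - (\<lambda>y. a * g y)"
      by (auto simp: fun_eq_iff algebra_simps)
    then show ?thesis
      using mult[OF g j] g vs.span_diff vs.span_scale unfolding W_def by simp
  qed

  define \<delta> where "\<delta> y = (\<lambda>x. if x = y then 1 else 0 :: 'a)" for y :: 'b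
  \<comment> \<open>Lagrange interpolation: for each other point \<open>y'\<close> a coordinate
    \<open>J y'\<close> separating it from \<open>y\<close> supplies a linear factor that vanishes
    at \<open>y'\<close>. These products lie in \<open>W\<close> because \<open>W\<close> is closed
    under multiplication by coordinates.\<close>
  have delta: "\<delta> y \<in> W" if y: "y \<in> Y" for y
  proof -
    obtain J where J: "\<And>y'. y' \<in> Y - {y} \<Longrightarrow> J y' < t \<and> u (J y') y \<noteq> u (J y') y'"
      using sep[OF y] by (metis DiffD1 DiffD2 insertCI)
    have one: "N (\<lambda>_. 1) \<in> W" using Dpos by (intro box) simp
    have "(\<lambda>x. (\<Prod>y'\<in>Z. u (J y') x - u (J y') y') * N (\<lambda>_. 1) x) \<in> W"
      if "finite Z" "Z \<subseteq> Y - {y}" for Z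
      using that
    proof (induction Z)
      case empty
      then show ?case using one by simp
    next
      case (insert z Z)
      have "(\<lambda>x. (u (J z) x - u (J z) z) * ((\<Prod>y'\<in>Z. u (J y') x - u (J y') y') * N (\<lambda>_. 1) x)) \<in> W"
        using insert J by (intro mult') auto
      then show ?case using insert by (simp add: mult_ac)
    qed
    from this[of "Y - {y}"]
    have in_W: "(\<lambda>x. (\<Prod>y'\<in>Y - {y}. u (J y') x - u (J y') y') * N (\<lambda>_. 1) x) \<in> W"
      using finY by simp
    define a where "a = (\<Prod>y'\<in>Y - {y}. u (J y') y - u (J y') y')"
    have a: "a \<noteq> 0" unfolding a_def using J finY by (auto simp: prod_zero_iff)
    have "\<delta> y = (\<lambda>x. (1 / a) * ((\<Prod>y'\<in>Y - {y}. u (J y') x - u (J y') y') * N (\<lambda>_. 1) x))"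
    proof
      fix x
      show "\<delta> y x = (1 / a) * ((\<Prod>y'\<in>Y - {y}. u (J y') x - u (J y') y') * N (\<lambda>_. 1) x)"
      proof (cases "x = y")
        case True
        then show ?thesis using y a by (simp add: \<delta>_def N_def a_def)
      next
        case False
        moreover have "(\<Prod>y'\<in>Y - {y}. u (J y') x - u (J y') y') = 0" if "x \<in> Y"
          using False that finY by (auto simp: prod_zero_iff)
        ultimately show ?thesis by (auto simp: \<delta>_def N_def)
      qed
    qed
    then show ?thesis using vs.span_scale[OF in_W[unfolded W_def], of "1 / a"] unfolding W_def
      by (simp only:)
  qed

  have inj: "inj_on \<delta> Y"
    by (rule inj_onI) (auto simp: \<delta>_def fun_eq_iff split: if_splits)
  \<comment> \<open>Evaluation at \<open>y\<close> kills all other indicators but not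
    \<open>\<delta> y\<close>. Independence inside the span of \<open>B\<close> then bounds
    \<open>card Y\<close> by the number \<open>D ^ t\<close> of exponent vectors.\<close>
  have indep: "\<not> vs.dependent (\<delta> ` Y)"
  proof
    assume "vs.dependent (\<delta> ` Y)"
    then obtain y where y: "y \<in> Y" "\<delta> y \<in> vs.span (\<delta> ` Y - {\<delta> y})"
      by (auto simp: vs.dependent_def)
    have "vs.subspace {g. g y = 0}" by (auto simp: vs.subspace_def)
    moreover have "\<delta> ` Y - {\<delta> y} \<subseteq> {g. g y = 0}" by (auto simp: \<delta>_def)
    ultimately have "\<delta> y \<in> {g. g y = 0}" using y(2) vs.span_minimal by blast
    then show False by (simp add: \<delta>_def)
  qed
  have finB: "finite B" unfolding B_def by (intro finite_imageI finite_PiE) auto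
  have "card Y = card (\<delta> ` Y)" using inj by (simp add: card_image)
  also have "\<dots> \<le> card B"
    using vs.independent_span_bound[OF finB indep] delta by (auto simp: W_def)
  also have "\<dots> \<le> card (PiE {..<t} (\<lambda>_. {..<D}))"
    unfolding B_def by (intro card_image_le finite_PiE) auto
  also have "\<dots> = D ^ t" by (simp add: card_PiE)
  finally show ?thesis by (simp add: D_def)
qed

section \<open>Finite fields and norm equations\<close>

text \<open>Over an algebraically closed field \<open>p\<close> splits into linear factors, and a
  repeated factor would give a common root of \<open>p\<close> and its derivative.\<close>

lemma card_roots_alg_closed:
  fixes p :: "'a::alg_closed_field poly"
  assumes "p \<noteq> 0" and simple: "\<And>a. poly p a = 0 \<Longrightarrow> poly (pderiv p) a \<noteq> 0"
  shows "card {x. poly p x = 0} = degree p"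
proof -
  obtain A where A: "size A = degree p" "p = smult (lead_coeff p) (\<Prod>x\<in>#A. [:-x, 1:])"
    using alg_closed_imp_factorization[OF assms(1)] by blast
  have roots: "poly p x = 0 \<longleftrightarrow> x \<in># A" for x
    by (subst A(2)) (use assms(1) in \<open>auto simp: poly_prod_mset prod_mset_zero_iff\<close>)
  have "count A x \<le> 1" for x
  proof (rule ccontr)
    assume "\<not> count A x \<le> 1"
    then have "{#x, x#} \<subseteq># A"
      by (auto simp: subseteq_mset_def)
    then obtain B where "A = add_mset x (add_mset x B)"
      by (metis add_mset_add_single mset_subset_eq_exists_conv union_mset_add_mset_left add_0)
    then have "p = [:-x, 1:] * ([:-x, 1:] * smult (lead_coeff p) (\<Prod>x\<in>#B. [:-x, 1:]))"
      using A(2) by (simp add: mult_ac)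
    then obtain r where "p = [:-x, 1:] * ([:-x, 1:] * r)" by blast
    then have r: "p = [:-x, 1:] * ([:-x, 1:] * r)" .
    have "poly p x = 0" "poly (pderiv p) x = 0"
      by (simp_all only: r pderiv_mult poly_add poly_mult) simp_all
    then show False using simple by blast
  qed
  then have c1: "count A x = 1" if "x \<in># A" for x
    using that by (metis count_greater_zero_iff le_antisym Suc_leI One_nat_def)
  have "size A = (\<Sum>x\<in>set_mset A. count A x)" by (rule size_multiset_overloaded_eq)
  also have "\<dots> = card (set_mset A)" using c1 by simp
  also have "set_mset A = {x. poly p x = 0}" using roots by auto
  finally show ?thesis using A(1) by simp
qed

text \<open>The fixed points are the roots of X^q - X with \<open>q = CHAR('a) ^ m\<close>, whose
  derivative is the constant -1. This realises finite fields as subsets of one algebraically closed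
  field.\<close>

lemma card_frobenius_fixed:
  assumes "prime CHAR('a::alg_closed_field)" "m > 0"
  shows "card {x::'a. x ^ (CHAR('a) ^ m) = x} = CHAR('a) ^ m"
proof -
  define q where "q = CHAR('a) ^ m"
  have q: "q > 1" unfolding q_def by (rule one_less_power[OF prime_gt_1_nat[OF assms(1)] assms(2)])
  define p where "p = monom 1 q - monom (1::'a) 1"
  have "degree p = q"
    unfolding p_def using q by (subst diff_conv_add_uminus, subst degree_add_eq_left)
      (auto simp: degree_monom_eq)
  moreover have "poly (pderiv p) a = - 1" for a
  proof -
    have "of_nat q = (0::'a)" using assms by (auto simp: q_def of_nat_eq_0_iff_char_dvd)
    then show ?thesis by (simp add: p_def pderiv_diff pderiv_monom poly_monom)
  qed
  ultimately have "card {x. poly p x = 0} = q"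
    using q by (subst card_roots_alg_closed) auto
  moreover have "poly p x = 0 \<longleftrightarrow> x ^ q = x" for x
    by (simp add: p_def poly_monom)
  ultimately show ?thesis by (simp add: q_def)
qed

text \<open>The power map is additive, so the power of \<open>x - y\<close> vanishes.\<close>

lemma frobenius_inj:
  fixes x y :: "'a::field"
  assumes "prime CHAR('a)" "x ^ (CHAR('a) ^ n) = y ^ (CHAR('a) ^ n)"
  shows "x = y"
proof -
  have "((x - y) + y) ^ (CHAR('a) ^ n) = (x - y) ^ (CHAR('a) ^ n) + y ^ (CHAR('a) ^ n)"
    by (rule freshmans_dream'[OF assms(1) refl])
  then show ?thesis using assms(2) by simp
qed

text \<open>Greedy choice of a basis: fewer than \<open>r\<close> elements span fewer than
  \<open>card K\<close> elements, so some element of \<open>K\<close> remains. Independence is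
  stated as injectivity on coordinate vectors, since \<open>L\<close> is only a subset of the
  ambient field.\<close>

lemma exists_independent:
  fixes L K :: "'a::field set"
  assumes L: "0 \<in> L" "1 < card L" "\<And>x y. x \<in> L \<Longrightarrow> y \<in> L \<Longrightarrow> x - y \<in> L"
      "\<And>x y. x \<in> L \<Longrightarrow> y \<in> L \<Longrightarrow> x / y \<in> L"
    and "card L ^ r \<le> card K" "k \<le> r"
  shows "\<exists>\<omega>. (\<forall>i<k. \<omega> i \<in> K) \<and> inj_on (\<lambda>x. \<Sum>i<k. \<omega> i * x i) (PiE {..<k} (\<lambda>_. L))"
  using \<open>k \<le> r\<close>
proof (induction k)
  case 0
  then show ?case by simp
next
  case (Suc k)
  then obtain \<omega> where \<omega>: "\<forall>i<k. \<omega> i \<in> K"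
    "inj_on (\<lambda>x. \<Sum>i<k. \<omega> i * x i) (PiE {..<k} (\<lambda>_. L))" by auto
  have finL: "finite L" using L(2) card.infinite by fastforce
  define S where "S = (\<lambda>x. \<Sum>i<k. \<omega> i * x i) ` PiE {..<k} (\<lambda>_. L)"
  have "card S \<le> card L ^ k"
    unfolding S_def using card_image_le[OF finite_PiE, of "{..<k}" "\<lambda>_. L"] finL
    by (simp add: card_PiE)
  also have "\<dots> < card L ^ r" using L(2) Suc.prems by (intro power_strict_increasing) auto
  also have "\<dots> \<le> card K" by fact
  finally have "\<not> K \<subseteq> S"
    using card_mono[of S K] finL by (auto simp: S_def intro!: finite_imageI finite_PiE)
  then obtain w where w: "w \<in> K" "w \<notin> S" by auto
  define \<omega>' where "\<omega>' = fun_upd \<omega> k w"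
  have sum': "(\<Sum>i<Suc k. \<omega>' i * x i) = (\<Sum>i<k. \<omega> i * x i) + w * x k" for x
    by (simp add: \<omega>'_def)
  have "inj_on (\<lambda>x. \<Sum>i<Suc k. \<omega>' i * x i) (PiE {..<Suc k} (\<lambda>_. L))"
  proof (rule inj_onI)
    fix x y assume x: "x \<in> PiE {..<Suc k} (\<lambda>_. L)" and y: "y \<in> PiE {..<Suc k} (\<lambda>_. L)"
      and "(\<Sum>i<Suc k. \<omega>' i * x i) = (\<Sum>i<Suc k. \<omega>' i * y i)"
    then have eq: "(\<Sum>i<k. \<omega> i * x i) + w * x k = (\<Sum>i<k. \<omega> i * y i) + w * y k"
      by (simp only: sum')
    have xy: "x i \<in> L" "y i \<in> L" if "i < Suc k" for i
      using x y that by (simp_all add: PiE_iff)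
    have k: "x k = y k"
    proof (rule ccontr)
      assume "x k \<noteq> y k"
      then have ne: "y k - x k \<noteq> 0" by simp
      \<comment> \<open>If the last coordinates differ, solving for \<open>w\<close> puts it into
        the span \<open>S\<close>.\<close>
      define z where "z = restrict (\<lambda>i. (x i - y i) / (y k - x k)) {..<k}"
      have "z \<in> PiE {..<k} (\<lambda>_. L)"
        using xy by (simp add: z_def PiE_iff L(3,4))
      moreover have "w = (\<Sum>i<k. \<omega> i * z i)"
      proof -
        have "w * (y k - x k) = (\<Sum>i<k. \<omega> i * x i) - (\<Sum>i<k. \<omega> i * y i)"
          using eq by (simp add: algebra_simps)
        also have "\<dots> = (\<Sum>i<k. \<omega> i * (x i - y i))"
          by (simp add: sum_subtractf right_diff_distrib)
        finally have "w = (\<Sum>i<k. \<omega> i * (x i - y i)) / (y k - x k)"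
          using ne by (metis nonzero_mult_div_cancel_right)
        then show ?thesis by (simp add: sum_divide_distrib z_def)
      qed
      ultimately show False using w(2) by (auto simp: S_def)
    qed
    have "restrict x {..<k} = restrict y {..<k}"
      using \<omega>(2) by (rule inj_onD) (use xy eq k in \<open>simp_all add: PiE_iff\<close>)
    then have "x i = y i" if "i < k" for i
      using that by (metis restrict_apply' lessThan_iff)
    then show "x = y"
      using k by (intro PiE_ext[OF x y]) (auto simp: less_Suc_eq)
  qed
  moreover have "\<forall>i<Suc k. \<omega>' i \<in> K" using \<omega>(1) w by (auto simp: \<omega>'_def less_Suc_eq)
  ultimately show ?case by blast
qed

text \<open>The colour of \<open>z\<close> is the number of Frobenius steps from \<open>z\<close> to a chosen representative of
  its orbit.\<close>

lemma frobenius_orbit_colour: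
  fixes Q r :: nat and K :: "'a::field set"
  assumes "r > 0" and inj: "\<And>k (x::'a) y. x ^ (Q ^ k) = y ^ (Q ^ k) \<Longrightarrow> x = y"
    and K: "K = {z. z ^ (Q ^ r) = z}"
  shows "\<exists>\<kappa>. (\<forall>z\<in>K. \<kappa> z < r) \<and>
    (\<forall>z\<in>K. \<forall>z'\<in>K. \<forall>a b. \<kappa> z = \<kappa> z' \<and> z ^ (Q ^ a) = z' ^ (Q ^ b) \<longrightarrow> z = z')"
proof -
  define orb where "orb z = range (\<lambda>k. z ^ (Q ^ k))" for z :: 'a
  \<comment> \<open>\<open>\<rho> z\<close> depends on the set \<open>orb z\<close> only, so
    conjugate elements share their representative.\<close>
  define \<rho> where "\<rho> z = (SOME w. w \<in> orb z)" for z
  define \<kappa> where "\<kappa> z = (SOME k. k < r \<and> z ^ (Q ^ k) = \<rho> z)" for z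
  have per: "z ^ (Q ^ (k + a * r)) = z ^ (Q ^ k)" if "z \<in> K" for z k a
  proof (induction a)
    case (Suc a)
    have "k + Suc a * r = r + (k + a * r)" by simp
    then have "z ^ (Q ^ (k + Suc a * r)) = (z ^ (Q ^ r)) ^ (Q ^ (k + a * r))"
      by (simp only: power_mult[symmetric] power_add[symmetric])
    then show ?case using Suc that by (simp add: K)
  qed simp
  have \<kappa>: "\<kappa> z < r \<and> z ^ (Q ^ \<kappa> z) = \<rho> z" if "z \<in> K" for z
  proof -
    have "z \<in> orb z" unfolding orb_def by (rule range_eqI[of _ _ 0]) simp
    then have "\<rho> z \<in> orb z" unfolding \<rho>_def by (rule someI)
    then obtain k where "\<rho> z = z ^ (Q ^ k)" by (auto simp: orb_def)
    then have "k mod r < r \<and> z ^ (Q ^ (k mod r)) = \<rho> z"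
      using per[OF that, of "k mod r" "k div r"] assms(1) by (simp add: add.commute)
    then show ?thesis unfolding \<kappa>_def by (rule someI)
  qed
  have orb_pow: "orb (z ^ (Q ^ a)) = orb z" if "z \<in> K" for z a
  proof
    show "orb (z ^ (Q ^ a)) \<subseteq> orb z"
      unfolding orb_def power_mult[symmetric] power_add[symmetric] by blast
    show "orb z \<subseteq> orb (z ^ (Q ^ a))"
    proof
      fix w assume "w \<in> orb z"
      then obtain k where "w = z ^ (Q ^ k)" by (auto simp: orb_def)
      \<comment> \<open>Going round \<open>a\<close> full periods makes the exponent large enough to
        split off \<open>a\<close> steps.\<close>
      also have "\<dots> = z ^ (Q ^ (k + a * r))" using per[OF that] by simp
      also have "k + a * r = a + (k + a * (r - 1))" using assms(1) by (cases r) auto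
      also have "z ^ (Q ^ (a + (k + a * (r - 1)))) = (z ^ (Q ^ a)) ^ (Q ^ (k + a * (r - 1)))"
        by (simp add: power_mult[symmetric] power_add)
      finally show "w \<in> orb (z ^ (Q ^ a))" by (auto simp: orb_def)
    qed
  qed
  have "z = z'" if "z \<in> K" "z' \<in> K" "\<kappa> z = \<kappa> z'" "z ^ (Q ^ a) = z' ^ (Q ^ b)" for z z' a b
  proof -
    have "orb z = orb z'" using orb_pow that by metis
    then have "\<rho> z = \<rho> z'" by (simp add: \<rho>_def)
    then have "z ^ (Q ^ \<kappa> z) = z' ^ (Q ^ \<kappa> z)" using \<kappa> that by metis
    then show ?thesis by (rule inj)
  qed
  then show ?thesis using \<kappa> by blast
qed

text \<open>Write \<open>l = j + t * k\<close>. Since \<open>y\<close> is fixed by the power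
  \<open>CHAR('a) ^ (m * t)\<close>, its conjugate depends only on \<open>j\<close>, so the norm
  becomes a product over \<open>j < t\<close> of polynomials \<open>f i j\<close> of degree
  \<open>r\<close> in \<open>u j y\<close>. The orbit condition makes them coprime for distinct
  \<open>i\<close>, and \<open>box_bound\<close> applies with \<open>d = r\<close>.\<close>

lemma norm_form_bound:
  fixes \<theta> :: "nat \<Rightarrow> 'a::field"
  assumes char: "prime CHAR('a)" and "t > 0" "r > 0"
    and Y: "finite Y" "\<And>y. y \<in> Y \<Longrightarrow> y ^ (CHAR('a) ^ (m * t)) = y"
    and orbits: "\<And>i i' a b. i < t \<Longrightarrow> i' < t \<Longrightarrow> i \<noteq> i' \<Longrightarrow>
      \<theta> i ^ (CHAR('a) ^ (m * t * a)) \<noteq> \<theta> i' ^ (CHAR('a) ^ (m * t * b))"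
    and eqs: "\<And>y i. y \<in> Y \<Longrightarrow> i < t \<Longrightarrow>
      (\<Prod>l<t * r. (y + \<theta> i) ^ (CHAR('a) ^ (m * l))) = c"
  shows "card Y \<le> (t * r) ^ t"
proof -
  define p where "p = CHAR('a)"
  define f where "f i j = (\<Prod>k<r. [:\<theta> i ^ (p ^ (m * (j + t * k))), 1:])" for i j
  define u where "u j y = y ^ (p ^ (m * j))" for j and y :: 'a
  have Y': "y ^ (p ^ (m * t * k)) = y" if "y \<in> Y" for y k
  proof (induction k)
    case (Suc k)
    have "y ^ (p ^ (m * t * Suc k)) = (y ^ (p ^ (m * t * k))) ^ (p ^ (m * t))"
      by (simp add: power_mult[symmetric] power_add[symmetric] add.commute)
    then show ?case using Suc Y(2)[OF that] by (simp add: p_def)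
  qed simp
  show ?thesis
  proof (rule box_bound[where f = f and u = u and c = "\<lambda>_. c"])
    show "degree (f i j) = r \<and> lead_coeff (f i j) = 1" for i j
      using degree_monic_prod[of "{..<r}" "\<lambda>k. [:\<theta> i ^ (p ^ (m * (j + t * k))), 1:]" 1]
      by (simp add: f_def)
  next
    fix i i' j assume ii: "i < t" "i' < t" "i \<noteq> i'"
    have "\<theta> i ^ (p ^ (m * (j + t * k))) \<noteq> \<theta> i' ^ (p ^ (m * (j + t * k')))" for k k'
    proof
      assume eq: "\<theta> i ^ (p ^ (m * (j + t * k))) = \<theta> i' ^ (p ^ (m * (j + t * k')))"
      have "x ^ (p ^ (m * (j + t * l))) = (x ^ (p ^ (m * t * l))) ^ (p ^ (m * j))" for x :: 'a and l
        by (simp only: power_mult[symmetric] power_add[symmetric]) (simp add: algebra_simps)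
      then have "\<theta> i ^ (p ^ (m * t * k)) = \<theta> i' ^ (p ^ (m * t * k'))"
        using eq frobenius_inj[OF char] by (metis p_def)
      then show False using orbits[OF ii] by (auto simp: p_def)
    qed
    then show "\<exists>a b. a * f i j + b * f i' j = 1"
      unfolding f_def by (intro bezout_prod_linear) auto
  next
    fix y i assume y: "y \<in> Y" and i: "i < t"
    have "(\<Prod>j<t. poly (f i j) (u j y)) = (\<Prod>j<t. \<Prod>k<r. (y + \<theta> i) ^ (p ^ (m * (j + t * k))))"
    proof (intro prod.cong refl)
      fix j
      have "poly [:\<theta> i ^ (p ^ (m * (j + t * k))), 1:] (u j y) = (y + \<theta> i) ^ (p ^ (m * (j + t * k)))"
        for k
      proof -
        have "y ^ (p ^ (m * (j + t * k))) = (y ^ (p ^ (m * t * k))) ^ (p ^ (m * j))"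
          by (simp only: power_mult[symmetric] power_add[symmetric]) (simp add: algebra_simps)
        then have "u j y = y ^ (p ^ (m * (j + t * k)))" using Y'[OF y] by (simp add: u_def)
        then show ?thesis
          using freshmans_dream'[OF char refl, of y "\<theta> i"] by (simp add: p_def add.commute)
      qed
      then show "poly (f i j) (u j y) = (\<Prod>k<r. (y + \<theta> i) ^ (p ^ (m * (j + t * k))))"
        unfolding f_def poly_prod by (rule prod.cong[OF refl])
    qed
    also have "\<dots> = (\<Prod>(j, k)\<in>{..<t} \<times> {..<r}. (y + \<theta> i) ^ (p ^ (m * (j + t * k))))"
      by (rule prod.cartesian_product)
    also have "\<dots> = (\<Prod>l<t * r. (y + \<theta> i) ^ (p ^ (m * l)))"
    proof (rule prod.reindex_bij_witness[of _ "\<lambda>l. (l mod t, l div t)" "\<lambda>(j, k). j + t * k"], goal_cases)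
      case (2 x)
      then obtain j k where x: "x = (j, k)" "j < t" "k < r" by auto
      have "j + t * k < t * Suc k" using x by simp
      also have "\<dots> \<le> t * r" using x by (intro mult_le_mono) auto
      finally show ?case using x by simp
    qed (use \<open>t > 0\<close> in \<open>auto simp: less_mult_imp_div_less mult.commute\<close>)
    also have "\<dots> = c" using eqs[OF y i] by (simp add: p_def)
    finally show "(\<Prod>j<t. poly (f i j) (u j y)) = c" .
  next
    \<comment> \<open>\<open>u 0\<close> is the identity, so the first coordinate alone separates
      points.\<close>
    show "\<exists>j<t. u j y \<noteq> u j y'" if "y \<noteq> y'" for y y'
      using that \<open>t > 0\<close> by (intro exI[of _ 0]) (simp add: u_def)
  qed (use assms in auto)
qed

text \<open>\<open>L\<close> has order \<open>Q = q ^ t\<close> for \<open>q = CHAR('a) ^ m\<close>, and there are \<open>q * r ^ r\<close> pairs of a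
  norm and a colour pattern.\<close>

lemma algebraic_tuples:
  fixes m t r :: nat
  assumes char: "prime CHAR('a::alg_closed_field)" and pos: "m > 0" "t > 0" "r > 0"
  shows "\<exists>(L :: 'a set) G. finite L \<and> card L = CHAR('a) ^ (m * t) \<and> G \<subseteq> PiE {..<r} (\<lambda>_. L) \<and>
    (CHAR('a) ^ (m * t)) ^ r \<le> card G * (CHAR('a) ^ m * r ^ r) \<and>
    (\<forall>j<r. \<forall>x. (\<forall>i<t. x i \<in> PiE {..<r} (\<lambda>_. L)) \<and>
        (\<forall>i<t. \<forall>i'<t. i \<noteq> i' \<longrightarrow> (\<exists>l<r. l \<noteq> j \<and> x i l \<noteq> x i' l)) \<longrightarrow>
      card {z\<in>L. \<forall>i<t. (x i)(j := z) \<in> G} \<le> (t * r) ^ t)"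
proof -
  define p where "p = CHAR('a)"
  have p: "p > 1" using prime_gt_1_nat[OF char] by (simp add: p_def)
  define q where "q = p ^ m"
  define Q where "Q = p ^ (m * t)"
  \<comment> \<open>The fields of orders \<open>q\<close>, \<open>Q\<close> and \<open>Q ^ r\<close>
    are fixed point sets of Frobenius powers inside one algebraically closed field.\<close>
  define Fq where "Fq = {x::'a. x ^ q = x}"
  define L where "L = {x::'a. x ^ Q = x}"
  define K where "K = {x::'a. x ^ (Q ^ r) = x}"
  have Qr: "Q ^ r = p ^ (m * t * r)" by (simp add: Q_def power_mult)
  have cards: "card Fq = q" "card L = Q"
    using card_frobenius_fixed[OF char] pos by (simp_all add: Fq_def L_def q_def Q_def p_def)
  have cardK: "card K = Q ^ r"
    unfolding K_def Qr using card_frobenius_fixed[OF char, of "m * t * r"] pos by (simp add: p_def)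
  have gt1: "q > 1" "Q > 1" "Q ^ r > 1"
    using p pos by (auto simp: q_def Q_def simp del: One_nat_def intro!: one_less_power)
  have fin: "finite Fq" "finite L" "finite K"
    using cards cardK gt1 card.infinite by fastforce+
  have add_pow: "(x + y) ^ (p ^ k) = x ^ (p ^ k) + y ^ (p ^ k)" for x y :: 'a and k
    by (rule freshmans_dream'[OF char]) (simp add: p_def)
  have inj_pow: "x = y" if "x ^ (p ^ k) = y ^ (p ^ k)" for x y :: 'a and k
    using frobenius_inj[OF char] that by (simp add: p_def)
  have diff_pow: "(x - y) ^ (p ^ k) = x ^ (p ^ k) - y ^ (p ^ k)" for x y :: 'a and k
    using add_pow[of "x - y" y] by (simp add: algebra_simps)
  have sum_pow: "(\<Sum>i\<in>I. g i) ^ (p ^ k) = (\<Sum>i\<in>I. g i ^ (p ^ k))" for g :: "nat \<Rightarrow> 'a" and I k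
    by (rule freshmans_dream_sum'[OF char]) (simp add: p_def)
  have LK: "x \<in> K" if "x \<in> L" for x
  proof -
    have "x ^ (Q ^ k) = x" for k
      using that by (induction k) (simp_all add: L_def power_mult)
    then show ?thesis by (simp add: K_def)
  qed
  have L0: "0 \<in> L" using gt1 by (simp add: L_def)
  have "\<exists>\<omega>. (\<forall>i<r. \<omega> i \<in> K) \<and> inj_on (\<lambda>x. \<Sum>i<r. \<omega> i * x i) (PiE {..<r} (\<lambda>_. L))"
  proof (rule exists_independent[where r = r])
    show "x - y \<in> L" if "x \<in> L" "y \<in> L" for x y
      using that by (simp add: L_def Q_def diff_pow)
    show "x / y \<in> L" if "x \<in> L" "y \<in> L" for x y
      using that by (simp add: L_def power_divide)
  qed (use fin cards cardK gt1 L0 in auto)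
  then obtain \<omega> where \<omega>K: "\<And>i. i < r \<Longrightarrow> \<omega> i \<in> K"
    and \<omega>: "inj_on (\<lambda>x. \<Sum>i<r. \<omega> i * x i) (PiE {..<r} (\<lambda>_. L))" by blast
  define E where "E x = (\<Sum>i<r. \<omega> i * x i)" for x
  have injE: "x = y" if "E x = E y" "x \<in> PiE {..<r} (\<lambda>_. L)" "y \<in> PiE {..<r} (\<lambda>_. L)" for x y
    using \<omega> that unfolding E_def by (rule inj_onD)
  \<comment> \<open>A vanishing \<open>\<omega> j\<close> would hide the \<open>j\<close>-th
    coordinate from \<open>E\<close>, against injectivity.\<close>
  have \<omega>0: "\<omega> j \<noteq> 0" if j: "j < r" for j
  proof
    assume 0: "\<omega> j = 0"
    define x where "x = restrict (\<lambda>_. 0 :: 'a) {..<r}"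
    have x: "x \<in> PiE {..<r} (\<lambda>_. L)" using L0 by (simp add: x_def PiE_iff)
    have "x(j := 1) \<in> PiE {..<r} (\<lambda>_. L)"
      using x j by (auto simp: PiE_iff L_def extensional_def)
    moreover have "E (x(j := 1)) = E x"
      unfolding E_def by (intro sum.cong) (auto simp: 0)
    ultimately have "x(j := 1) = x" using x injE by blast
    then have "(x(j := 1)) j = x j" by simp
    then show False using j by (simp add: x_def)
  qed
  \<comment> \<open>\<open>\<theta> j x\<close> ignores \<open>x j\<close>; dividing by
    \<open>\<omega> j\<close> gives the coordinate \<open>j\<close> the coefficient 1.\<close>
  define \<theta> where "\<theta> j x = (\<Sum>i\<in>{..<r} - {j}. \<omega> i / \<omega> j * x i)" for j x
  have E\<theta>: "E x = \<omega> j * (x j + \<theta> j x)" if j: "j < r" for j x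
    using j \<omega>0[OF j]
    by (simp add: E_def \<theta>_def sum.remove[of "{..<r}" j] distrib_left sum_distrib_left)
  have \<theta>_upd: "\<theta> j (x(j := z)) = \<theta> j x" for j x z
    unfolding \<theta>_def by (intro sum.cong) auto
  have \<theta>K: "\<theta> j x \<in> K" if "j < r" "x \<in> PiE {..<r} (\<lambda>_. L)" for j x
  proof -
    have "(\<omega> i / \<omega> j * x i) ^ (Q ^ r) = \<omega> i / \<omega> j * x i" if "i < r" for i
      using \<omega>K[of i] \<omega>K[of j] LK[of "x i"] that \<open>j < r\<close> \<open>x \<in> _\<close>
      by (auto simp: K_def power_mult_distrib power_divide PiE_iff)
    then show ?thesis by (simp add: K_def \<theta>_def Qr sum_pow)
  qed
  \<comment> \<open>The norm from \<open>K\<close> to \<open>Fq\<close>: the product of all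
    \<open>t * r\<close> conjugates.\<close>
  define M where "M z = (\<Prod>l<t * r. z ^ (p ^ (m * l)))" for z :: 'a
  have M_mult: "M (a * b) = M a * M b" for a b
    by (simp add: M_def power_mult_distrib prod.distrib)
  have M0: "M z \<noteq> 0" if "z \<noteq> 0" for z
    using that by (simp add: M_def)
  have M_Fq: "M z \<in> Fq" if z: "z \<in> K" for z
  proof (cases "z = 0")
    case True
    have "M z = 0" unfolding M_def using True pos p by (auto simp: prod_zero_iff intro!: exI[of _ 0])
    then show ?thesis using gt1 by (simp add: Fq_def)
  next
    case False
    \<comment> \<open>Raising to the power \<open>q\<close> shifts the conjugates by one, and the
      cycle closes because \<open>z\<close> lies in \<open>K\<close>.\<close>
    have "M z ^ q = (\<Prod>l<t * r. z ^ (p ^ (m * Suc l)))"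
      unfolding M_def q_def prod_power_distrib
      by (simp add: power_mult[symmetric] power_add[symmetric] add.commute)
    then have "z * M z ^ q = (\<Prod>l<Suc (t * r). z ^ (p ^ (m * l)))"
      by (subst prod.lessThan_Suc_shift) simp
    also have "\<dots> = M z * z ^ (p ^ (m * (t * r)))" by (simp add: M_def)
    also have "z ^ (p ^ (m * (t * r))) = z" using z by (simp add: K_def Qr mult.assoc)
    finally show ?thesis using False by (simp add: Fq_def)
  qed
  have "\<exists>\<kappa>. (\<forall>z\<in>K. \<kappa> z < r) \<and>
    (\<forall>z\<in>K. \<forall>z'\<in>K. \<forall>a b. \<kappa> z = \<kappa> z' \<and> z ^ (Q ^ a) = z' ^ (Q ^ b) \<longrightarrow> z = z')"
    by (rule frobenius_orbit_colour[OF pos(3) _ K_def])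
      (metis inj_pow power_mult Q_def)
  then obtain \<kappa> where \<kappa>: "\<And>z. z \<in> K \<Longrightarrow> \<kappa> z < r"
    "\<And>z z' a b. z \<in> K \<Longrightarrow> z' \<in> K \<Longrightarrow> \<kappa> z = \<kappa> z' \<Longrightarrow> z ^ (Q ^ a) = z' ^ (Q ^ b) \<Longrightarrow> z = z'"
    by blast
  define col where "col x = (M (E x), restrict (\<lambda>j. \<kappa> (\<theta> j x)) {..<r})" for x
  define P where "P = PiE {..<r} (\<lambda>_. L)"
  define C where "C = Fq \<times> PiE {..<r} (\<lambda>_. {..<r})"
  have EK: "E x \<in> K" if "x \<in> P" for x
  proof -
    have "(\<omega> i * x i) ^ (Q ^ r) = \<omega> i * x i" if "i < r" for i
      using \<omega>K[of i] LK[of "x i"] that \<open>x \<in> P\<close>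
      by (auto simp: K_def power_mult_distrib PiE_iff P_def)
    then show ?thesis by (simp add: K_def E_def Qr sum_pow)
  qed
  \<comment> \<open>Pigeonhole selects a norm and a colour pattern attained by at least an average
    share of the tuples.\<close>
  have "\<exists>y\<in>C. card (col -` {y} \<inter> P) * card C \<ge> card P"
  proof (rule pigeonhole_card)
    show "col \<in> P \<rightarrow> C"
      using EK M_Fq \<kappa>(1) \<theta>K by (auto simp: col_def C_def P_def)
    show "C \<noteq> {}"
      using gt1 pos by (auto simp: C_def Fq_def PiE_eq_empty_iff intro!: exI[of _ 0])
  qed (use fin in \<open>auto simp: P_def C_def intro!: finite_PiE\<close>)
  then obtain y0 where y0: "card P \<le> card (col -` {y0} \<inter> P) * card C" by blast
  obtain c k where ck: "y0 = (c, k)" by fastforce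
  define G where "G = col -` {y0} \<inter> P"
  have G: "x \<in> P \<and> M (E x) = c \<and> (\<forall>j<r. \<kappa> (\<theta> j x) = k j)" if "x \<in> G" for x
  proof -
    have "restrict (\<lambda>j. \<kappa> (\<theta> j x)) {..<r} = k" using that by (simp add: G_def ck col_def)
    then have "\<forall>j<r. \<kappa> (\<theta> j x) = k j" by (metis lessThan_iff restrict_apply')
    then show ?thesis using that by (simp add: G_def ck col_def)
  qed
  have size: "Q ^ r \<le> card G * (q * r ^ r)"
    using y0 by (simp add: P_def C_def G_def card_PiE card_cartesian_product cards)
  have bound: "card {z\<in>L. \<forall>i<t. (x i)(j := z) \<in> G} \<le> (t * r) ^ t"
    if j: "j < r" and x: "\<forall>i<t. x i \<in> P"
      and dist: "\<forall>i<t. \<forall>i'<t. i \<noteq> i' \<longrightarrow> (\<exists>l<r. l \<noteq> j \<and> x i l \<noteq> x i' l)" for j x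
  proof (cases "{z\<in>L. \<forall>i<t. (x i)(j := z) \<in> G} = {}")
    case False
    \<comment> \<open>One solution suffices to read off the colour of every \<open>\<tau> i\<close>,
      because \<open>\<theta> j\<close> ignores the replaced coordinate.\<close>
    then obtain z0 where z0: "\<And>i. i < t \<Longrightarrow> (x i)(j := z0) \<in> G" by auto
    define \<tau> where "\<tau> i = \<theta> j (x i)" for i
    have \<tau>: "\<tau> i \<in> K" "\<kappa> (\<tau> i) = k j" if "i < t" for i
      using \<theta>K[OF j] x that G[OF z0[OF that]] j by (auto simp: \<tau>_def \<theta>_upd P_def)
    \<comment> \<open>Equal values would give equal \<open>E\<close> after coordinate
      \<open>j\<close> is set to 0, hence tuples agreeing off \<open>j\<close>.\<close>
    have \<tau>_ne: "\<tau> i \<noteq> \<tau> i'" if ii: "i < t" "i' < t" "i \<noteq> i'" for i i'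
    proof
      assume eq: "\<tau> i = \<tau> i'"
      have mem: "(x i)(j := 0) \<in> PiE {..<r} (\<lambda>_. L)" if "i < t" for i
        using x that j L0 by (auto simp: P_def PiE_iff extensional_def)
      have "E ((x i)(j := 0)) = E ((x i')(j := 0))"
        using eq by (simp add: E\<theta>[OF j] \<theta>_upd \<tau>_def)
      then have "(x i)(j := 0) = (x i')(j := 0)"
        using injE mem ii by blast
      then have "x i l = x i' l" if "l \<noteq> j" for l
        using that by (metis fun_upd_other)
      then show False using dist ii by blast
    qed
    show ?thesis
    proof (rule norm_form_bound[OF char pos(2,3), where \<theta> = \<tau> and m = m and c = "c / M (\<omega> j)"])
      show "finite {z\<in>L. \<forall>i<t. (x i)(j := z) \<in> G}" using fin by simp
      show "y ^ (CHAR('a) ^ (m * t)) = y" if "y \<in> {z\<in>L. \<forall>i<t. (x i)(j := z) \<in> G}" for y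
        using that by (simp add: L_def Q_def p_def)
      \<comment> \<open>The \<open>\<tau> i\<close> share the colour \<open>k j\<close> and are
        distinct, so no two are conjugate over \<open>L\<close>.\<close>
      show "\<tau> i ^ (CHAR('a) ^ (m * t * a)) \<noteq> \<tau> i' ^ (CHAR('a) ^ (m * t * b))"
        if ii: "i < t" "i' < t" "i \<noteq> i'" for i i' a b
        using \<kappa>(2)[of "\<tau> i" "\<tau> i'" a b] \<tau> \<tau>_ne[OF ii] ii by (auto simp: Q_def p_def power_mult)
    next
      fix y i assume y: "y \<in> {z\<in>L. \<forall>i<t. (x i)(j := z) \<in> G}" and i: "i < t"
      have "M (E ((x i)(j := y))) = c" using G y i by blast
      then have "M (\<omega> j) * M (y + \<tau> i) = c"
        by (simp add: E\<theta>[OF j] \<theta>_upd M_mult \<tau>_def)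
      then have "M (y + \<tau> i) = c / M (\<omega> j)"
        using M0[OF \<omega>0[OF j]] by (simp add: field_simps)
      then show "(\<Prod>l<t * r. (y + \<tau> i) ^ (CHAR('a) ^ (m * l))) = c / M (\<omega> j)"
        by (simp add: M_def p_def)
    qed
  qed (simp only: card.empty le0)
  have "G \<subseteq> P" by (simp add: G_def)
  then show ?thesis
    using size bound cards fin
    by (intro exI[of _ L] exI[of _ G]) (auto simp: p_def[symmetric] Q_def[symmetric] q_def[symmetric] P_def)
qed

section \<open>Links and copies of complete bipartite hypergraphs\<close>

lemma card_le_fibres:
  assumes "finite A" "finite B" "f ` A \<subseteq> B" "\<And>y. y \<in> B \<Longrightarrow> card {x\<in>A. f x = y} \<le> c"
  shows "card A \<le> card B * c"
proof -
  have "A = (\<Union>y\<in>B. {x\<in>A. f x = y})" using assms(3) by auto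
  then have "card A \<le> (\<Sum>y\<in>B. card {x\<in>A. f x = y})"
    using card_UN_le[OF assms(2), of "\<lambda>y. {x\<in>A. f x = y}"] by simp
  also have "\<dots> \<le> card B * c" using sum_bounded_above[of B _ c] assms(4) by simp
  finally show ?thesis .
qed

text \<open>The condition \<open>y \<notin> W\<close> admits an edge with \<open>y\<close> removed,
  but not that edge itself.\<close>

definition link :: "'a hypergraph \<Rightarrow> 'a \<Rightarrow> 'a set set" where
  "link G y = {W. y \<notin> W \<and> insert y W \<in> edges G}"

text \<open>Tuples are ordered, which makes extension by one entry easy to count; \<open>PiE\<close>
  fixes the values outside the index range and so keeps the set finite for finite
  \<open>F\<close>.\<close>

definition disjoint_tuples :: "nat \<Rightarrow> 'a set set \<Rightarrow> (nat \<Rightarrow> 'a set) set" where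
  "disjoint_tuples m F =
     {W \<in> PiE {..<m} (\<lambda>_. F). \<forall>i<m. \<forall>j<m. i \<noteq> j \<longrightarrow> W i \<inter> W j = {}}"

definition bipartite_hypergraph :: "nat \<Rightarrow> 'a set \<Rightarrow> (nat \<Rightarrow> 'a set) \<Rightarrow> 'a hypergraph" where
  "bipartite_hypergraph t Y W = Hypergraph ((\<Union>i<t. W i) \<union> Y) {insert y (W i) | i y. i < t \<and> y \<in> Y}"

lemma link_subset:
  assumes "r_graph r G"
  shows "link G y \<subseteq> {W. W \<subseteq> verts G \<and> card W = r - 1}"
proof
  fix W assume "W \<in> link G y"
  then have W: "y \<notin> W" "insert y W \<in> edges G" by (auto simp: link_def)
  then have "insert y W \<subseteq> verts G" "card (insert y W) = r"
    using assms by (auto simp: r_graph_def)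
  moreover from this have "finite W" using assms by (meson finite_subset insert_subset r_graph_def)
  ultimately show "W \<in> {W. W \<subseteq> verts G \<and> card W = r - 1}" using W by auto
qed

lemma finite_link: "r_graph r G \<Longrightarrow> finite (link G y)"
  by (rule finite_subset[OF link_subset]) (auto simp: r_graph_def)

lemma finite_disjoint_tuples: "finite F \<Longrightarrow> finite (disjoint_tuples m F)"
  unfolding disjoint_tuples_def
  by (rule finite_subset[OF _ finite_PiE[of "{..<m}" "\<lambda>_. F"]]) auto

lemma card_subsets_le_power:
  assumes "finite V"
  shows "card {W. W \<subseteq> V \<and> card W = k} \<le> card V ^ k"
proof (cases "k \<le> card V")
  case True
  then show ?thesis using assms by (simp add: n_subsets binomial_le_pow)
next
  case False
  then show ?thesis using assms by (simp add: n_subsets binomial_eq_0)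
qed

text \<open>Union bound over the vertices of \<open>U\<close>; removing a fixed vertex
  \<open>v\<close> injects the sets through \<open>v\<close> into the \<open>(k - 1)\<close>-subsets
  of \<open>V\<close>.\<close>

lemma card_meeting_le:
  assumes "finite V" "F \<subseteq> {W. W \<subseteq> V \<and> card W = k}" "finite U" "k \<ge> 1"
  shows "card {Z\<in>F. Z \<inter> U \<noteq> {}} \<le> card U * card V ^ (k - 1)"
proof -
  have fin: "finite {Z\<in>F. P Z}" for P
    using assms by (auto intro: finite_subset[OF _ finite_Pow_iff[THEN iffD2, OF assms(1)]])
  have one: "card {Z\<in>F. v \<in> Z} \<le> card V ^ (k - 1)" for v
  proof -
    have "inj_on (\<lambda>Z. Z - {v}) {Z\<in>F. v \<in> Z}"
      by (rule inj_onI) (metis (mono_tags, lifting) insert_Diff mem_Collect_eq)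
    then have "card {Z\<in>F. v \<in> Z} = card ((\<lambda>Z. Z - {v}) ` {Z\<in>F. v \<in> Z})"
      by (simp add: card_image)
    also have "\<dots> \<le> card {W. W \<subseteq> V \<and> card W = k - 1}"
      using assms by (intro card_mono) (auto intro: finite_subset)
    also have "\<dots> \<le> card V ^ (k - 1)" by (rule card_subsets_le_power[OF assms(1)])
    finally show ?thesis .
  qed
  have "{Z\<in>F. Z \<inter> U \<noteq> {}} = (\<Union>v\<in>U. {Z\<in>F. v \<in> Z})" by auto
  then have "card {Z\<in>F. Z \<inter> U \<noteq> {}} \<le> (\<Sum>v\<in>U. card {Z\<in>F. v \<in> Z})"
    using card_UN_le[OF assms(3), of "\<lambda>v. {Z\<in>F. v \<in> Z}"] by simp
  also have "\<dots> \<le> card U * card V ^ (k - 1)"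
    using sum_bounded_above[of U "\<lambda>v. card {Z\<in>F. v \<in> Z}" "card V ^ (k - 1)"] one by simp
  finally show ?thesis .
qed

text \<open>Greedy choice: the sets chosen so far have at most \<open>M * k\<close> vertices, so by
  \<open>large\<close> at most half of \<open>F\<close> meets them. The separate bound
  \<open>M\<close> stays fixed in the induction on \<open>m\<close>.\<close>

lemma card_disjoint_tuples_ge:
  assumes "finite V" "F \<subseteq> {W. W \<subseteq> V \<and> card W = k}" "k \<ge> 1"
    and large: "2 * M * k * card V ^ (k - 1) \<le> card F" and "m \<le> M"
  shows "card F ^ m \<le> 2 ^ m * card (disjoint_tuples m F)"
  using \<open>m \<le> M\<close>
proof (induction m)
  case 0
  then show ?case by (simp add: disjoint_tuples_def)
next
  case (Suc m)
  have finF: "finite F"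
    using assms by (auto intro: finite_subset[OF _ finite_Pow_iff[THEN iffD2, OF assms(1)]])
  define R where "R W = {Z\<in>F. Z \<inter> (\<Union>i<m. W i) = {}}" for W :: "nat \<Rightarrow> 'a set"
  have finR: "finite (R W)" for W using finF by (simp add: R_def)
  have R: "card F \<le> 2 * card (R W)" if W: "W \<in> disjoint_tuples m F" for W
  proof -
    have XF: "W i \<subseteq> V" "card (W i) = k" if "i < m" for i
      using W that assms(2) by (auto simp: disjoint_tuples_def PiE_iff)
    have finU: "finite (\<Union>i<m. W i)"
      using XF assms(1) by (auto intro: finite_subset)
    have "card (\<Union>i<m. W i) \<le> (\<Sum>i<m. card (W i))" by (rule card_UN_le) simp
    then have U: "card (\<Union>i<m. W i) \<le> m * k" using XF by simp
    have "F = R W \<union> {Z\<in>F. Z \<inter> (\<Union>i<m. W i) \<noteq> {}}" by (auto simp: R_def)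
    then have "card F \<le> card (R W) + card {Z\<in>F. Z \<inter> (\<Union>i<m. W i) \<noteq> {}}"
      by (metis card_Un_le)
    also have "card {Z\<in>F. Z \<inter> (\<Union>i<m. W i) \<noteq> {}} \<le> card (\<Union>i<m. W i) * card V ^ (k - 1)"
      by (rule card_meeting_le[OF assms(1,2) finU assms(3)])
    also have "\<dots> \<le> M * k * card V ^ (k - 1)"
      using Suc.prems by (intro mult_right_mono order_trans[OF U]) auto
    finally show ?thesis using large by simp
  qed
  have inj: "inj_on (\<lambda>(W, Z). W(m := Z)) (SIGMA W:disjoint_tuples m F. R W)"
  proof (rule inj_onI, clarsimp)
    fix W Z W' Z' assume W: "W \<in> disjoint_tuples m F" "W' \<in> disjoint_tuples m F"
      and eq: "W(m := Z) = W'(m := Z')"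
    have "W i = W' i" for i
    proof (cases "i = m")
      case True
      \<comment> \<open>Extensionality recovers the value at \<open>m\<close> that the update
        overwrites.\<close>
      have "W m = undefined" "W' m = undefined"
        using W by (auto simp: disjoint_tuples_def PiE_iff extensional_def)
      then show ?thesis using True by simp
    next
      case False
      then show ?thesis using fun_cong[OF eq, of i] by simp
    qed
    moreover have "Z = Z'" using fun_cong[OF eq, of m] by simp
    ultimately show "W = W' \<and> Z = Z'" by auto
  qed
  have sub: "(\<lambda>(W, Z). W(m := Z)) ` (SIGMA W:disjoint_tuples m F. R W) \<subseteq> disjoint_tuples (Suc m) F"
  proof clarify
    fix W Z assume W: "W \<in> disjoint_tuples m F" and Z: "Z \<in> R W"
    have "W(m := Z) \<in> PiE {..<Suc m} (\<lambda>_. F)"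
      using W Z by (auto simp: disjoint_tuples_def R_def PiE_iff extensional_def less_Suc_eq)
    moreover have "Z \<inter> W i = {}" "W i \<inter> Z = {}" if "i < m" for i using Z that by (auto simp: R_def)
    ultimately show "W(m := Z) \<in> disjoint_tuples (Suc m) F"
      using W by (auto simp: disjoint_tuples_def less_Suc_eq)
  qed
  have "card F ^ Suc m \<le> 2 ^ m * (\<Sum>W\<in>disjoint_tuples m F. card F)"
    using Suc by (simp add: mult.commute[of "card F"] mult.assoc[symmetric])
  also have "(\<Sum>W\<in>disjoint_tuples m F. card F) \<le> (\<Sum>W\<in>disjoint_tuples m F. 2 * card (R W))"
    by (rule sum_mono) (rule R)
  also have "\<dots> = 2 * card (SIGMA W:disjoint_tuples m F. R W)"
    using finR finite_disjoint_tuples[OF finF] by (simp add: sum_distrib_left)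
  also have "card (SIGMA W:disjoint_tuples m F. R W) \<le> card (disjoint_tuples (Suc m) F)"
    using card_inj_on_le[OF inj sub finite_disjoint_tuples[OF finF]] .
  finally show ?case by simp
qed

text \<open>All counting of copies goes through this description: one disjoint tuple
  \<open>W\<close> has to lie in the link of every vertex of \<open>Y\<close>. Membership in the
  links also gives the block size \<open>r - 1\<close> and keeps \<open>Y\<close> off the
  blocks.\<close>

lemma copies_complete_bipartite:
  assumes G: "r_graph r G" and pos: "r \<ge> 1" "s > 0" "t > 0"
  shows "copies (complete_bipartite r s t) G
    = {bipartite_hypergraph t Y W | Y W. card Y = s \<and> (\<forall>y\<in>Y. W \<in> disjoint_tuples t (link G y))}" (is "_ = ?R")
proof
  show "copies (complete_bipartite r s t) G \<subseteq> ?R"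
  proof
    fix S assume "S \<in> copies (complete_bipartite r s t) G"
    then obtain f where SG: "subhypergraph S G"
      and f: "bij_betw f ((\<Union>i<t. block r i) \<union> Inr ` {..<s}) (verts S)"
      and ed: "edges S = (\<lambda>e. f ` e) ` {block r i \<union> {Inr y} | i y. i < t \<and> y < s}"
      by (auto simp: copies_def isomorphic_def complete_bipartite_def)
    define Y where "Y = (\<lambda>l. f (Inr l)) ` {..<s}"
    define W where "W = restrict (\<lambda>i. f ` block r i) {..<t}"
    have inj: "inj_on f ((\<Union>i<t. block r i) \<union> Inr ` {..<s})" using f by (simp add: bij_betw_def)
    have "inj_on (\<lambda>l. f (Inr l)) {..<s}"
      by (rule inj_onI) (use inj_onD[OF inj] in blast)
    then have cY: "card Y = s" by (simp add: Y_def card_image)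
    have v: "verts S = (\<Union>i<t. W i) \<union> Y"
      using bij_betw_imp_surj_on[OF f, symmetric]
      by (simp add: image_Un image_UN image_image W_def Y_def)
    have "edges S = {insert y (W i) | i y. i < t \<and> y \<in> Y}"
    proof -
      have eq: "f ` (block r i \<union> {Inr y}) = insert (f (Inr y)) (f ` block r i)" for i y by auto
      have "edges S = {f ` (block r i \<union> {Inr y}) | i y. i < t \<and> y < s}"
        unfolding ed by blast
      also have "\<dots> = {insert (f (Inr y)) (W i) | i y. i < t \<and> y < s}"
        unfolding eq by (intro Collect_cong ex_cong1) (auto simp: W_def)
      also have "\<dots> = {insert y (W i) | i y. i < t \<and> y \<in> Y}"
        unfolding Y_def by blast
      finally show ?thesis .
    qed
    then have S: "S = bipartite_hypergraph t Y W" using v by (cases S) (simp add: bipartite_hypergraph_def)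
    have "W \<in> disjoint_tuples t (link G y)" if y: "y \<in> Y" for y
    proof -
      obtain l where l: "y = f (Inr l)" "l < s" using y by (auto simp: Y_def)
      have "y \<notin> W i" if "i < t" for i
      proof
        assume "y \<in> W i"
        then have "f (Inr l) \<in> f ` block r i" using that l by (simp add: W_def)
        then obtain z where z: "z \<in> block r i" "f z = f (Inr l)" by (metis imageE)
        then have "z = Inr l" using that l by (intro inj_onD[OF inj]) auto
        then show False using z by (simp add: block_def)
      qed
      moreover have "insert y (W i) \<in> edges G" if "i < t" for i
      proof -
        have "{insert y (W i) | i y. i < t \<and> y \<in> Y} \<subseteq> edges G"
          using SG S by (simp add: subhypergraph_def bipartite_hypergraph_def)
        then show ?thesis using y that by blast
      qed
      moreover have "W i \<inter> W j = {}" if ij: "i < t" "j < t" "i \<noteq> j" for i j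
      proof -
        have "block r i \<inter> block r j = {}" using ij by (auto simp: block_def)
        then have "f ` block r i \<inter> f ` block r j = {}"
          using inj_on_image_Int[OF inj, of "block r i" "block r j"] ij by auto
        then show ?thesis using ij by (simp add: W_def)
      qed
      ultimately show ?thesis by (simp add: disjoint_tuples_def link_def PiE_iff W_def)
    qed
    then show "S \<in> ?R" using S cY by blast
  qed
next
  show "?R \<subseteq> copies (complete_bipartite r s t) G"
  proof clarify
    fix Y W assume s: "s = card Y" and W: "\<forall>y\<in>Y. W \<in> disjoint_tuples t (link G y)"
    have finY: "finite Y" "Y \<noteq> {}" using pos s by (auto intro: card_ge_0_finite)
    then obtain y0 where y0: "y0 \<in> Y" by auto
    have link: "W i \<in> link G y" if "i < t" "y \<in> Y" for i y
      using W that by (auto simp: disjoint_tuples_def PiE_iff)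
    have Xi: "W i \<subseteq> verts G" "card (W i) = r - 1" "finite (W i)" if "i < t" for i
      using link_subset[OF G] link[OF that y0] G by (auto simp: r_graph_def intro: finite_subset)
    have disj: "W i \<inter> W j = {}" if "i < t" "j < t" "i \<noteq> j" for i j
      using W y0 that by (auto simp: disjoint_tuples_def)
    have "\<exists>g. bij_betw g {..<r - 1} (W i)" if "i < t" for i
      using Xi[OF that] ex_bij_betw_nat_finite[of "W i"] by (auto simp: atLeast0LessThan)
    then obtain g where g: "\<And>i. i < t \<Longrightarrow> bij_betw (g i) {..<r - 1} (W i)" by metis
    obtain h where h: "bij_betw h {..<s} Y"
      using ex_bij_betw_nat_finite[OF finY(1)] s by (auto simp: atLeast0LessThan)
    define f where "f z = (case z of Inl (i, j) \<Rightarrow> g i j | Inr l \<Rightarrow> h l)" for z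
    have fblock: "f ` block r i = W i" if "i < t" for i
    proof -
      have "block r i = (\<lambda>j. Inl (i, j)) ` {..<r - 1}" by (auto simp: block_def)
      then show ?thesis using g[OF that] by (simp add: image_image f_def bij_betw_def)
    qed
    have fInr: "f ` Inr ` {..<s} = Y" using h by (simp add: image_image f_def bij_betw_def)
    let ?A = "(\<Union>i<t. block r i) \<union> Inr ` {..<s}"
    have img: "f ` ?A = (\<Union>i<t. W i) \<union> Y" by (simp add: image_Un image_UN fblock fInr)
    have "inj_on f ?A"
    proof (rule inj_onI)
      have YX: "h l \<notin> W i" if "i < t" "l < s" for i l
        using link[OF that(1), of "h l"] h that by (auto simp: link_def bij_betw_def)
      have gX: "g i j \<in> W i" if "i < t" "j < r - 1" for i j
        using g[OF that(1)] that by (auto simp: bij_betw_def)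
      fix a b assume a: "a \<in> ?A" and b: "b \<in> ?A" and eq: "f a = f b"
      have ginj: "j = j'" if "i < t" "j < r - 1" "j' < r - 1" "g i j = g i j'" for i j j'
        using g[OF that(1)] that by (auto simp: bij_betw_def inj_on_def)
      have hinj: "l = l'" if "l < s" "l' < s" "h l = h l'" for l l'
        using h that by (auto simp: bij_betw_def inj_on_def)
      from a consider (W) i j where "a = Inl (i, j)" "i < t" "j < r - 1" | (Y) l where "a = Inr l" "l < s"
        by (auto simp: block_def)
      then show "a = b"
      proof cases
        case W
        have "b \<noteq> Inr l" for l
          using eq b W YX[of i] gX[of i j] by (auto simp: f_def block_def)
        then obtain i' j' where b': "b = Inl (i', j')" "i' < t" "j' < r - 1"
          using b by (auto simp: block_def)
        have "g i j = g i' j'" using eq W b' by (simp add: f_def)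
        then have "i = i'" using disj[of i i'] gX[of i j] gX[of i' j'] W b' by auto
        then show ?thesis using ginj[of i j j'] \<open>g i j = g i' j'\<close> W b' by simp
      next
        case Y
        have "b \<noteq> Inl z" for z
          using eq b Y YX gX by (auto simp: f_def block_def) metis
        then obtain l' where "b = Inr l'" "l' < s" using b by (auto simp: block_def)
        then show ?thesis using eq Y hinj[of l l'] by (simp add: f_def)
      qed
    qed
    then have bij: "bij_betw f (verts (complete_bipartite r s t)) (verts (bipartite_hypergraph t Y W))"
      using img by (simp add: bij_betw_def complete_bipartite_def bipartite_hypergraph_def)
    have eds: "edges (bipartite_hypergraph t Y W) = (\<lambda>e. f ` e) ` edges (complete_bipartite r s t)"
    proof -
      have e: "f ` (block r i \<union> {Inr l}) = insert (h l) (W i)" if "i < t" for i l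
        using fblock[OF that] by (auto simp: f_def image_Un)
      have Y: "Y = h ` {..<s}" using h by (simp add: bij_betw_def)
      have "edges (bipartite_hypergraph t Y W) = {insert (h l) (W i) | i l. i < t \<and> l < s}"
        unfolding bipartite_hypergraph_def Y hypergraph.sel by blast
      also have "\<dots> = {f ` (block r i \<union> {Inr l}) | i l. i < t \<and> l < s}"
        by (intro Collect_cong ex_cong1) (use e in auto)
      also have "\<dots> = (\<lambda>e. f ` e) ` {block r i \<union> {Inr l} | i l. i < t \<and> l < s}"
        by blast
      finally show ?thesis by (simp add: complete_bipartite_def)
    qed
    have edG: "insert y (W i) \<in> edges G" if "i < t" "y \<in> Y" for i y
      using link[OF that] by (simp add: link_def)
    have "Y \<subseteq> verts G"
    proof
      fix y assume "y \<in> Y"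
      then have "insert y (W 0) \<in> edges G" using edG pos(3) by blast
      then show "y \<in> verts G" using G by (auto simp: r_graph_def)
    qed
    moreover have "edges (bipartite_hypergraph t Y W) \<subseteq> edges G" using edG by (auto simp: bipartite_hypergraph_def)
    moreover have "(\<Union>i<t. W i) \<subseteq> verts G" using Xi(1) by blast
    ultimately have "subhypergraph (bipartite_hypergraph t Y W) G"
      by (auto simp: subhypergraph_def bipartite_hypergraph_def)
    then show "bipartite_hypergraph t Y W \<in> copies (complete_bipartite r (card Y) t) G"
      using bij eds s by (auto simp: copies_def isomorphic_def)
  qed
qed

section \<open>Double counting of stars and of disjoint tuples\<close>

lemma card_star_copies_le:
  assumes G: "r_graph r G" and "r \<ge> 1" "b > 0"
  shows "card (copies (complete_bipartite r 1 b) G) \<le> (\<Sum>y\<in>verts G. card (link G y) ^ b)"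
proof -
  define P where "P = (SIGMA y:verts G. PiE {..<b} (\<lambda>_. link G y))"
  have finP: "finite P"
    unfolding P_def using G finite_link[OF G] by (auto simp: r_graph_def intro!: finite_PiE)
  have "copies (complete_bipartite r 1 b) G \<subseteq> (\<lambda>(y, W). bipartite_hypergraph b {y} W) ` P"
  proof
    fix S assume "S \<in> copies (complete_bipartite r 1 b) G"
    then obtain Y W where YX: "S = bipartite_hypergraph b Y W" "card Y = 1" "\<forall>y\<in>Y. W \<in> disjoint_tuples b (link G y)"
      using copies_complete_bipartite[OF G assms(2) _ assms(3), of 1] by auto
    then obtain y where Y: "Y = {y}" by (metis card_1_singletonE)
    have W: "W \<in> PiE {..<b} (\<lambda>_. link G y)" using YX(3) Y by (simp add: disjoint_tuples_def)
    then have "insert y (W 0) \<in> edges G" using assms(3) by (auto simp: link_def PiE_iff)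
    then have "y \<in> verts G" using G by (auto simp: r_graph_def)
    then show "S \<in> (\<lambda>(y, W). bipartite_hypergraph b {y} W) ` P" using W YX(1) Y by (auto simp: P_def)
  qed
  then have "card (copies (complete_bipartite r 1 b) G) \<le> card P"
    using finP by (rule surj_card_le[rotated])
  also have "\<dots> = (\<Sum>y\<in>verts G. card (link G y) ^ b)"
    unfolding P_def using G finite_link[OF G]
    by (subst card_SigmaI) (auto simp: r_graph_def card_PiE intro!: finite_PiE)
  finally show ?thesis .
qed

text \<open>A star may come from several pairs of a centre and a tuple. It has at most
  \<open>M\<close> vertices, which leaves at most \<open>M\<close> centres and \<open>2 ^ M\<close>
  choices for each of the \<open>b\<close> blocks.\<close>

lemma card_star_copies_ge:
  assumes G: "r_graph r G" and "r \<ge> 1" "b > 0"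
  defines "M \<equiv> b * (r - 1) + 1"
  shows "(\<Sum>y\<in>verts G. card (disjoint_tuples b (link G y)))
    \<le> card (copies (complete_bipartite r 1 b) G) * (M * (2 ^ M) ^ b)"
proof -
  define P where "P = (SIGMA y:verts G. disjoint_tuples b (link G y))"
  have fin: "finite (disjoint_tuples b (link G y))" for y
    by (rule finite_disjoint_tuples[OF finite_link[OF G]])
  have finP: "finite P" unfolding P_def using G fin by (auto simp: r_graph_def)
  have "(\<Sum>y\<in>verts G. card (disjoint_tuples b (link G y))) = card P"
    unfolding P_def using G fin by (subst card_SigmaI) (auto simp: r_graph_def)
  also have "\<dots> \<le> card (copies (complete_bipartite r 1 b) G) * (M * (2 ^ M) ^ b)"
  proof (rule card_le_fibres[OF finP card_copies_le(1)[OF G], where f = "\<lambda>(y, W). bipartite_hypergraph b {y} W"])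
    show "(\<lambda>(y, W). bipartite_hypergraph b {y} W) ` P \<subseteq> copies (complete_bipartite r 1 b) G"
      using copies_complete_bipartite[OF G assms(2) _ assms(3), of 1]
      by (auto simp: P_def) (metis card_1_singleton_iff One_nat_def singletonD)
  next
    fix S assume "S \<in> copies (complete_bipartite r 1 b) G"
    then have S: "isomorphic (complete_bipartite r 1 b) S" "verts S \<subseteq> verts G"
      by (auto simp: copies_def subhypergraph_def)
    have finS: "finite (verts S)" using S(2) G by (auto simp: r_graph_def intro: finite_subset)
    have "card (verts S) = card (verts (complete_bipartite r 1 b))"
      using S(1) by (metis isomorphic_def bij_betw_same_card)
    also have "verts (complete_bipartite r 1 b) = (\<Union>i<b. block r i) \<union> {Inr 0}"
      by (simp add: complete_bipartite_def lessThan_Suc)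
    also have "card \<dots> \<le> card (\<Union>i<b. block r i) + 1" by (rule order_trans[OF card_Un_le]) simp
    also have "\<dots> \<le> (\<Sum>i<b. card (block r i)) + 1" by (intro add_right_mono card_UN_le) simp
    also have "\<dots> = M" by (simp add: card_block M_def)
    finally have cS: "card (verts S) \<le> M" .
    have "{x\<in>P. (case x of (y, W) \<Rightarrow> bipartite_hypergraph b {y} W) = S} \<subseteq> verts S \<times> PiE {..<b} (\<lambda>_. Pow (verts S))"
    proof clarify
      fix y W assume P: "(y, W) \<in> P" and S: "S = bipartite_hypergraph b {y} W"
      have "W \<in> extensional {..<b}"
        using P by (simp add: P_def disjoint_tuples_def PiE_iff)
      moreover have "W i \<subseteq> verts S" if "i < b" for i using that S by (auto simp: bipartite_hypergraph_def)
      ultimately show "y \<in> verts (bipartite_hypergraph b {y} W) \<and> W \<in> PiE {..<b} (\<lambda>_. Pow (verts (bipartite_hypergraph b {y} W)))"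
        using S by (simp add: PiE_iff bipartite_hypergraph_def)
    qed
    then have "card {x\<in>P. (case x of (y, W) \<Rightarrow> bipartite_hypergraph b {y} W) = S}
        \<le> card (verts S \<times> PiE {..<b} (\<lambda>_. Pow (verts S)))"
      using finS by (intro card_mono) (auto intro!: finite_PiE)
    also have "\<dots> = card (verts S) * (2 ^ card (verts S)) ^ b"
      using finS by (simp add: card_cartesian_product card_PiE card_Pow)
    also have "\<dots> \<le> M * (2 ^ M) ^ b"
      using cS by (intro mult_mono power_mono power_increasing) auto
    finally show "card {x\<in>P. (case x of (y, W) \<Rightarrow> bipartite_hypergraph b {y} W) = S} \<le> M * (2 ^ M) ^ b" .
  qed
  finally show ?thesis .
qed

text \<open>A disjoint tuple in the links of \<open>s\<close> vertices would form the forbidden copy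
  with them, so each tuple of \<open>(r - 1)\<close>-subsets is counted fewer than \<open>s\<close>
  times.\<close>

lemma sum_disjoint_tuples_le:
  assumes G: "r_graph r G" and "r \<ge> 1" "s > 0" "t > 0"
    and free: "free_of (complete_bipartite r s t) G"
  shows "(\<Sum>y\<in>verts G. card (disjoint_tuples t (link G y))) \<le> (card (verts G) ^ (r - 1)) ^ t * s"
proof -
  define V where "V = {W. W \<subseteq> verts G \<and> card W = r - 1}"
  define P where "P = (SIGMA y:verts G. disjoint_tuples t (link G y))"
  have finG: "finite (verts G)" using G by (simp add: r_graph_def)
  have finV: "finite V" using finG by (simp add: V_def)
  have fin: "finite (disjoint_tuples t (link G y))" for y
    by (rule finite_disjoint_tuples[OF finite_link[OF G]])
  have finP: "finite P" unfolding P_def using finG fin by auto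
  have "(\<Sum>y\<in>verts G. card (disjoint_tuples t (link G y))) = card P"
    unfolding P_def using finG fin by (subst card_SigmaI) auto
  also have "\<dots> \<le> card (PiE {..<t} (\<lambda>_. V)) * s"
  proof (rule card_le_fibres[where f = snd])
    show "snd ` P \<subseteq> PiE {..<t} (\<lambda>_. V)"
    proof clarify
      fix y W assume "(y, W) \<in> P"
      then have "W \<in> PiE {..<t} (\<lambda>_. link G y)" by (simp add: P_def disjoint_tuples_def)
      also have "\<dots> \<subseteq> PiE {..<t} (\<lambda>_. V)"
        unfolding V_def by (rule PiE_mono) (rule link_subset[OF G])
      finally show "snd (y, W) \<in> PiE {..<t} (\<lambda>_. V)" by simp
    qed
  next
    fix W
    define Z where "Z = {y\<in>verts G. W \<in> disjoint_tuples t (link G y)}"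
    have finZ: "finite Z" using finG by (simp add: Z_def)
    have "card Z < s"
    proof (rule ccontr)
      assume "\<not> card Z < s"
      then obtain Y where "Y \<subseteq> Z" "card Y = s"
        by (meson not_less obtain_subset_with_card_n)
      then have "bipartite_hypergraph t Y W \<in> copies (complete_bipartite r s t) G"
        unfolding copies_complete_bipartite[OF assms(1-4)] by (auto simp: Z_def)
      then show False using free by (simp add: free_of_def)
    qed
    moreover have "{x\<in>P. snd x = W} = (\<lambda>y. (y, W)) ` Z" by (auto simp: P_def Z_def)
    ultimately show "card {x\<in>P. snd x = W} \<le> s"
      using card_image_le[OF finZ, of "\<lambda>y. (y, W)"] by simp
  qed (use finP finV in \<open>auto intro!: finite_PiE\<close>)
  also have "card (PiE {..<t} (\<lambda>_. V)) = card V ^ t" by (simp add: card_PiE)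
  also have "card V ^ t * s \<le> (card (verts G) ^ (r - 1)) ^ t * s"
    using card_subsets_le_power[OF finG, of "r - 1"] by (intro mult_right_mono power_mono) (auto simp: V_def)
  finally show ?thesis .
qed

lemma card_edges_le_sum_links:
  assumes G: "r_graph r G" and "r \<ge> 1"
  shows "card (edges G) \<le> (\<Sum>y\<in>verts G. card (link G y))"
proof -
  have finG: "finite (verts G)" using G by (simp add: r_graph_def)
  have "edges G \<subseteq> (\<lambda>(y, W). insert y W) ` (SIGMA y:verts G. link G y)"
  proof
    fix e assume e: "e \<in> edges G"
    then have "e \<subseteq> verts G" "card e = r" using G by (auto simp: r_graph_def)
    then obtain y where y: "y \<in> e" using assms(2) by fastforce
    then have "insert y (e - {y}) = e" by auto
    then show "e \<in> (\<lambda>(y, W). insert y W) ` (SIGMA y:verts G. link G y)"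
      using e y \<open>e \<subseteq> verts G\<close> by (intro image_eqI[of _ _ "(y, e - {y})"]) (auto simp: link_def)
  qed
  then have "card (edges G) \<le> card (SIGMA y:verts G. link G y)"
    using finG finite_link[OF G] by (intro surj_card_le[of _ _ "\<lambda>(y, W). insert y W"]) auto
  also have "\<dots> = (\<Sum>y\<in>verts G. card (link G y))"
    using finG finite_link[OF G] by (subst card_SigmaI) auto
  finally show ?thesis .
qed

section \<open>A dense hypergraph without large complete bipartite subhypergraphs\<close>

text \<open>Tuples become edges of an \<open>r\<close>-partite hypergraph with one copy of
  \<open>L\<close> per coordinate; any further vertices are isolated. In a forbidden copy all of
  \<open>Y\<close> lies in one part \<open>j\<close>, so its vertices vary the \<open>j\<close>-th
  coordinate of \<open>t\<close> fixed tuples, and \<open>bound\<close> limits their number.\<close>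

lemma partite_hypergraph_free:
  fixes L :: "'b set" and P :: "(nat \<Rightarrow> 'b) set"
  assumes "finite L" and P: "P \<subseteq> PiE {..<r} (\<lambda>_. L)"
    and "r \<ge> 2" "t > 0" "s > 0" "r * card L \<le> n"
    and bound: "\<And>j x. j < r \<Longrightarrow> \<forall>i<t. x i \<in> PiE {..<r} (\<lambda>_. L) \<Longrightarrow>
        \<forall>i<t. \<forall>i'<t. i \<noteq> i' \<longrightarrow> (\<exists>l<r. l \<noteq> j \<and> x i l \<noteq> x i' l) \<Longrightarrow>
        card {z\<in>L. \<forall>i<t. (x i)(j := z) \<in> P} < s"
  shows "\<exists>H :: nat hypergraph. r_graph r H \<and> card (verts H) = n \<and>
    free_of (complete_bipartite r s t) H \<and> card (edges H) = card P"
proof -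
  have "card ({..<r} \<times> L) \<le> card {..<n}" using assms(6) by (simp add: card_cartesian_product)
  then obtain g where g: "g ` ({..<r} \<times> L) \<subseteq> {..<n}" "inj_on g ({..<r} \<times> L)"
    using card_le_inj[of "{..<r} \<times> L" "{..<n}"] assms(1) by auto
  define edge where "edge x = (\<lambda>i. g (i, x i)) ` {..<r}" for x
  have g_eq: "i = i' \<and> z = z'" if "g (i, z) = g (i', z')" "i < r" "i' < r" "z \<in> L" "z' \<in> L" for i i' z z'
    using inj_onD[OF g(2) that(1)] that by simp
  have PL: "x i \<in> L" if "x \<in> P" "i < r" for x i using P that by (auto simp: PiE_iff)
  have mem: "g (i, z) \<in> edge x \<longleftrightarrow> x i = z" if "x \<in> P" "i < r" "z \<in> L" for x i z
    using g_eq PL that by (fastforce simp: edge_def)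
  have card_edge: "card (edge x) = r" if "x \<in> P" for x
  proof -
    have "inj_on (\<lambda>i. g (i, x i)) {..<r}"
      by (rule inj_onI) (use g_eq PL that in blast)
    then show ?thesis by (simp add: edge_def card_image)
  qed
  have inj: "inj_on edge P"
  proof (rule inj_onI)
    fix x y assume x: "x \<in> P" and y: "y \<in> P" and eq: "edge x = edge y"
    have "x i = y i" if "i < r" for i
    proof -
      have "g (i, y i) \<in> edge x" using eq that by (simp add: edge_def)
      then show ?thesis using mem x y that PL by blast
    qed
    then show "x = y" using x y P by (intro PiE_ext[of x "{..<r}" "\<lambda>_. L" y]) auto
  qed
  define H where "H = Hypergraph {..<n} (edge ` P)"
  have "edge x \<subseteq> {..<n}" if "x \<in> P" for x
    using g(1) PL that by (fastforce simp: edge_def)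
  then have rH: "r_graph r H" using card_edge by (simp add: H_def r_graph_def)
  moreover have "free_of (complete_bipartite r s t) H"
    unfolding free_of_def
  proof (rule equals0I)
    fix S assume "S \<in> copies (complete_bipartite r s t) H"
    then obtain Y W where Y: "card Y = s" and YW: "\<forall>y\<in>Y. W \<in> disjoint_tuples t (link H y)"
      using copies_complete_bipartite[OF rH _ assms(5,4)] assms(3) by auto
    have "\<exists>x. x \<in> P \<and> insert y (W i) = edge x" if "y \<in> Y" "i < t" for y i
      using YW that by (fastforce simp: disjoint_tuples_def link_def H_def PiE_iff)
    then obtain \<xi> where \<xi>: "\<And>y i. y \<in> Y \<Longrightarrow> i < t \<Longrightarrow> \<xi> y i \<in> P"
      "\<And>y i. y \<in> Y \<Longrightarrow> i < t \<Longrightarrow> insert y (W i) = edge (\<xi> y i)" by metis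
    have yW: "y \<notin> W i" if "y \<in> Y" "i < t" for y i
      using YW that by (auto simp: disjoint_tuples_def link_def PiE_iff)
    have disj: "W i \<inter> W i' = {}" if "i < t" "i' < t" "i \<noteq> i'" "y \<in> Y" for i i' y
      using YW that by (auto simp: disjoint_tuples_def)
    obtain y0 where y0: "y0 \<in> Y" using Y assms(5) by fastforce
    have pos: "\<exists>j<r. y = g (j, \<xi> y 0 j)" if "y \<in> Y" for y
    proof -
      have "y \<in> edge (\<xi> y 0)" using \<xi>(2)[OF that assms(4)] by blast
      then show ?thesis by (auto simp: edge_def)
    qed
    \<comment> \<open>\<open>j\<close> is the part containing \<open>y0\<close>; the other vertices
      of an edge \<open>insert y0 (W i)\<close> belong to the block \<open>W i\<close>.\<close>
    then obtain j where j: "j < r" "y0 = g (j, \<xi> y0 0 j)" using y0 by blast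
    have inW: "g (l, \<xi> y0 i l) \<in> W i" if "i < t" "l < r" "l \<noteq> j" for i l
    proof -
      have "g (l, \<xi> y0 i l) \<in> insert y0 (W i)"
        unfolding \<xi>(2)[OF y0 that(1)] using that by (simp add: edge_def)
      moreover have "g (l, \<xi> y0 i l) \<noteq> y0"
        using g_eq[of l "\<xi> y0 i l" j "\<xi> y0 0 j"] j that \<xi>(1)[OF y0] PL assms(4) by metis
      ultimately show ?thesis by simp
    qed
    have off: "\<xi> y i l = \<xi> y0 i l" if "y \<in> Y" "i < t" "l < r" "l \<noteq> j" for y i l
    proof -
      have "g (l, \<xi> y0 i l) \<in> edge (\<xi> y i)"
        using inW[OF that(2-4)] \<xi>(2)[OF that(1,2)] by blast
      then show ?thesis using mem \<xi>(1) PL that y0 by blast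
    qed
    define \<zeta> where "\<zeta> y = \<xi> y 0 j" for y
    have \<zeta>: "y = g (j, \<zeta> y)" "\<zeta> y \<in> L" if y: "y \<in> Y" for y
    proof -
      obtain j' where j': "j' < r" "y = g (j', \<xi> y 0 j')" using pos[OF y] by blast
      \<comment> \<open>A vertex \<open>y\<close> in another part would coincide with the vertex of
        \<open>W 0\<close> in that part, but links exclude \<open>y\<close> from the blocks.\<close>
      have "j' = j"
      proof (rule ccontr)
        assume ne: "j' \<noteq> j"
        then have "y \<in> W 0"
          using inW[OF assms(4) j'(1) ne] off[OF y assms(4) j'(1) ne] j'(2) by simp
        then show False using yW[OF y assms(4)] by simp
      qed
      then show "y = g (j, \<zeta> y)" using j' by (simp add: \<zeta>_def)
      show "\<zeta> y \<in> L" using PL \<xi>(1)[OF y assms(4)] j(1) by (simp add: \<zeta>_def)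
    qed
    have upd: "(\<xi> y0 i)(j := \<zeta> y) \<in> P" if y: "y \<in> Y" and i: "i < t" for y i
    proof -
      have "y \<in> edge (\<xi> y i)" using \<xi>(2)[OF y i] by blast
      then have "\<xi> y i j = \<zeta> y"
        using mem[OF \<xi>(1)[OF y i] j(1) \<zeta>(2)[OF y]] \<zeta>(1)[OF y] by simp
      moreover have "\<xi> y i l = \<xi> y0 i l" if "\<not> l < r" for l
      proof -
        have "x \<in> extensional {..<r}" if "x \<in> P" for x using P that by (auto simp: PiE_iff)
        then have "\<xi> y i \<in> extensional {..<r}" "\<xi> y0 i \<in> extensional {..<r}"
          using \<xi>(1)[OF y i] \<xi>(1)[OF y0 i] by blast+
        then show ?thesis using that by (simp add: extensional_def)
      qed
      ultimately have "(\<xi> y0 i)(j := \<zeta> y) = \<xi> y i"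
        using off[OF y i] by (intro ext) (metis fun_upd_apply)
      then show ?thesis using \<xi>(1)[OF y i] by simp
    qed
    have "card {z\<in>L. \<forall>i<t. (\<xi> y0 i)(j := z) \<in> P} < s"
    proof (rule bound[OF j(1)])
      show "\<forall>i<t. \<xi> y0 i \<in> PiE {..<r} (\<lambda>_. L)" using \<xi>(1)[OF y0] P by blast
      show "\<forall>i<t. \<forall>i'<t. i \<noteq> i' \<longrightarrow> (\<exists>l<r. l \<noteq> j \<and> \<xi> y0 i l \<noteq> \<xi> y0 i' l)"
      proof (intro allI impI)
        fix i i' assume i: "i < t" "i' < t" "i \<noteq> i'"
        \<comment> \<open>Some coordinate other than \<open>j\<close>, available because
          \<open>r \<ge> 2\<close>; disjoint blocks differ there.\<close>
        define l where "l = (if j = 0 then 1 else 0 :: nat)"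
        have l: "l < r" "l \<noteq> j" using assms(3) by (auto simp: l_def)
        have "\<xi> y0 i l \<noteq> \<xi> y0 i' l"
        proof
          assume "\<xi> y0 i l = \<xi> y0 i' l"
          then have "g (l, \<xi> y0 i l) \<in> W i \<inter> W i'"
            using inW[OF i(1) l] inW[OF i(2) l] by simp
          then show False using disj[OF i y0] by simp
        qed
        then show "\<exists>l<r. l \<noteq> j \<and> \<xi> y0 i l \<noteq> \<xi> y0 i' l" using l by blast
      qed
    qed
    moreover have "card Y \<le> card {z\<in>L. \<forall>i<t. (\<xi> y0 i)(j := z) \<in> P}"
    proof (rule card_inj_on_le)
      show "inj_on \<zeta> Y" by (rule inj_onI) (metis \<zeta>(1))
      show "\<zeta> ` Y \<subseteq> {z\<in>L. \<forall>i<t. (\<xi> y0 i)(j := z) \<in> P}" using \<zeta>(2) upd by auto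
    qed (use assms(1) in simp)
    ultimately show False using Y by simp
  qed
  ultimately show ?thesis
    using inj by (intro exI[of _ H]) (simp add: H_def card_image)
qed

lemma CHAR_bit: "CHAR(bit) = 2"
proof (rule CHAR_eqI)
  show "of_nat 2 = (0::bit)" by simp
  show "2 dvd n" if "of_nat n = (0::bit)" for n
    using that by (cases "even n") (auto elim!: oddE)
qed

text \<open>Take the largest field order \<open>Q m\<close> with \<open>r * Q m \<le> n\<close>.
  Consecutive orders differ by the factor \<open>2 ^ t\<close>, so \<open>Q m\<close> is of order
  \<open>n\<close>; the loss \<open>2 ^ m\<close> is \<open>Q m\<close> to the power
  \<open>1 / t\<close>, which gives the exponent.\<close>

lemma many_edges_free:
  fixes r s t :: nat
  assumes "r \<ge> 2" "t > 0" "s > (t * r) ^ t"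
  shows "\<exists>c>0. eventually (\<lambda>n. \<exists>H :: nat hypergraph. r_graph r H \<and> card (verts H) = n \<and>
    free_of (complete_bipartite r s t) H \<and>
    c * real n powr (real r - 1 / real t) \<le> real (card (edges H))) sequentially"
proof -
  have char: "CHAR(bit alg_closure) = 2" by (simp add: CHAR_bit)
  define e where "e = real r - 1 / real t"
  have "1 / real t \<le> 1" using assms(2) by simp
  then have e: "e \<ge> 0" using assms(1) by (simp add: e_def)
  \<comment> \<open>\<open>real r * 2 ^ t\<close> compares \<open>n\<close> with \<open>Q m\<close>,
    and \<open>real r ^ r\<close> counts the colour patterns.\<close>
  define c where "c = 1 / (real r ^ r * (real r * 2 ^ t) powr e)"
  have c: "c > 0" using assms(1) by (simp add: c_def)
  have "\<exists>H :: nat hypergraph. r_graph r H \<and> card (verts H) = n \<and>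
    free_of (complete_bipartite r s t) H \<and> c * real n powr e \<le> real (card (edges H))"
    if n: "n \<ge> r * 2 ^ t" for n
  proof -
    define Q where "Q m = (2::nat) ^ (m * t)" for m
    define m where "m = (GREATEST m. r * Q m \<le> n)"
    \<comment> \<open>Bounds the candidates, so that a greatest one exists.\<close>
    have bd: "m' \<le> n" if "r * Q m' \<le> n" for m'
    proof -
      have "m' \<le> m' * t" using assms(2) by simp
      also have "\<dots> \<le> Q m'" unfolding Q_def by (rule less_imp_le[OF less_exp])
      also have "\<dots> \<le> r * Q m'" using assms(1) by simp
      finally show ?thesis using that by simp
    qed
    have "r * Q 1 \<le> n" using n by (simp add: Q_def)
    then have m: "r * Q m \<le> n"
      unfolding m_def by (rule GreatestI_nat) (use bd in blast)
    have m_max: "m' \<le> m" if "r * Q m' \<le> n" for m'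
      unfolding m_def using that by (rule Greatest_le_nat) (use bd in blast)
    have m1: "m > 0" using m_max[of 1] n by (simp add: Q_def)
    have "\<not> r * Q (Suc m) \<le> n" using m_max[of "Suc m"] by auto
    then have "n \<le> r * 2 ^ t * Q m" by (simp add: Q_def power_add mult_ac)
    then have "real n \<le> real (r * 2 ^ t * Q m)" by (simp only: of_nat_le_iff)
    then have nQ: "real n / (real r * 2 ^ t) \<le> real (Q m)" using assms(1) by (simp add: field_simps)
    obtain L :: "bit alg_closure set" and P where L: "finite L" "card L = Q m"
      and P: "P \<subseteq> PiE {..<r} (\<lambda>_. L)" "Q m ^ r \<le> card P * (2 ^ m * r ^ r)"
      and bound: "\<And>j x. j < r \<Longrightarrow> \<forall>i<t. x i \<in> PiE {..<r} (\<lambda>_. L) \<Longrightarrow>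
        \<forall>i<t. \<forall>i'<t. i \<noteq> i' \<longrightarrow> (\<exists>l<r. l \<noteq> j \<and> x i l \<noteq> x i' l) \<Longrightarrow>
        card {z\<in>L. \<forall>i<t. (x i)(j := z) \<in> P} \<le> (t * r) ^ t"
      using algebraic_tuples[where ?'a = "bit alg_closure", of m t r] m1 assms(1,2)
      unfolding char Q_def by auto
    have "\<exists>H :: nat hypergraph. r_graph r H \<and> card (verts H) = n \<and>
        free_of (complete_bipartite r s t) H \<and> card (edges H) = card P"
      by (rule partite_hypergraph_free[OF L(1) P(1) assms(1,2)])
        (use assms(3) m L(2) le_less_trans[OF bound assms(3)] in auto)
    then obtain H :: "nat hypergraph" where H: "r_graph r H" "card (verts H) = n"
      "free_of (complete_bipartite r s t) H" "card (edges H) = card P" by blast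
    have "c * real n powr e = (real n / (real r * 2 ^ t)) powr e / real r ^ r"
      using assms(1) by (simp add: c_def powr_divide)
    also have "\<dots> \<le> real (Q m) powr e / real r ^ r"
      using nQ e by (intro divide_right_mono powr_mono2) auto
    also have "real (Q m) powr e = real (Q m) ^ r / 2 ^ m"
    proof -
      have "real (Q m) powr (1 / real t) = 2 ^ m"
        using assms(2) by (simp add: Q_def powr_powr flip: powr_realpow)
      then show ?thesis by (simp add: e_def powr_diff powr_realpow Q_def)
    qed
    also have "real (Q m) ^ r / 2 ^ m / real r ^ r \<le> real (card P)"
    proof -
      have "real (Q m ^ r) \<le> real (card P * (2 ^ m * r ^ r))" using P(2) by (simp only: of_nat_le_iff)
      then show ?thesis using assms(1) by (simp add: field_simps)
    qed
    finally show ?thesis using H by auto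
  qed
  then have "eventually (\<lambda>n. \<exists>H :: nat hypergraph. r_graph r H \<and> card (verts H) = n \<and>
    free_of (complete_bipartite r s t) H \<and> c * real n powr e \<le> real (card (edges H))) sequentially"
    by (rule eventually_sequentiallyI)
  then show ?thesis using c unfolding e_def by blast
qed

section \<open>Asymptotics\<close>

text \<open>The exponent on the right is larger by \<open>1 - 1 / t\<close>, which is positive for
  \<open>t \<ge> 2\<close>. This makes links above the threshold large enough for the greedy choice
  of disjoint tuples.\<close>

lemma eventually_degree_threshold:
  fixes A c :: real
  assumes "k \<ge> 1" "t \<ge> 2" "c > 0"
  shows "eventually (\<lambda>n. A * real n ^ (k - 1) \<le> c * real n powr (real k - 1 / real t)) sequentially"
proof -
  define a where "a = 1 - 1 / real t"
  have a: "a > 0" using assms(2) by (simp add: a_def)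
  \<comment> \<open>The maximum with 1 keeps \<open>B\<close> positive, so that the powers
    \<open>1 / a\<close> and \<open>a\<close> cancel.\<close>
  define B where "B = max (A / c) 1"
  have "eventually (\<lambda>n. B powr (1 / a) \<le> real n) sequentially"
    by (rule eventually_sequentiallyI[of "nat \<lceil>B powr (1 / a)\<rceil>"]) linarith
  moreover have "eventually (\<lambda>n. n > 0) sequentially" by (rule eventually_gt_at_top)
  ultimately show ?thesis
  proof eventually_elim
    case (elim n)
    have "B = (B powr (1 / a)) powr a" using a by (simp add: powr_powr B_def)
    also have "\<dots> \<le> real n powr a" using elim(1) a by (intro powr_mono2) auto
    finally have "A \<le> c * real n powr a" using assms(3) by (simp add: B_def field_simps)
    then have "A * real n ^ (k - 1) \<le> c * (real n powr a * real n ^ (k - 1))"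
      by (simp add: mult_right_mono flip: mult.assoc)
    moreover have pk: "real n ^ (k - 1) = real n powr (real k - 1)"
      using elim(2) assms(1) by (simp add: powr_realpow[symmetric] of_nat_diff)
    moreover have "real n powr a * real n powr (real k - 1) = real n powr (real k - 1 / real t)"
      by (simp add: a_def flip: powr_add)
    ultimately show ?case by simp
  qed
qed

text \<open>A degree \<open>D\<close> above \<open>\<theta>\<close> satisfies
  \<open>D ^ b \<le> D ^ t / \<theta> ^ (t - b)\<close>, and \<open>D ^ t\<close> is controlled by
  disjoint \<open>t\<close>-tuples. The choice of \<open>\<theta>\<close> gives the low-degree part
  \<open>n * \<theta> ^ b\<close> and the high-degree part the same order.\<close>

lemma eventually_copies_le:
  fixes r s t b :: nat
  assumes "r \<ge> 2" "0 < b" "b < t" "s > 0"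
  shows "eventually (\<lambda>n. \<forall>G :: 'a hypergraph. r_graph r G \<and> card (verts G) = n \<and>
      free_of (complete_bipartite r s t) G \<longrightarrow>
      real (card (copies (complete_bipartite r 1 b) G))
        \<le> (1 + 2 ^ t * real s) * real n powr (1 + real b * (real r - 1) - real b / real t)) sequentially"
proof -
  define k where "k = r - 1"
  have k: "k \<ge> 1" "real k = real r - 1" using assms(1) by (simp_all add: k_def)
  have "eventually (\<lambda>n. (2 * real t * real k) * real n ^ (k - 1) \<le> 1 * real n powr (real k - 1 / real t)) sequentially"
    using assms k by (intro eventually_degree_threshold) auto
  moreover have "eventually (\<lambda>n. n > 0) sequentially" by (rule eventually_gt_at_top)
  ultimately show ?thesis
  proof eventually_elim
    case (elim n)
    define \<theta> where "\<theta> = real n powr (real k - 1 / real t)"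
    have \<theta>: "\<theta> > 0" using elim(2) by (simp add: \<theta>_def)
    show ?case
    proof (intro allI impI, elim conjE)
      fix G :: "'a hypergraph"
      assume G: "r_graph r G" and n: "card (verts G) = n" and free: "free_of (complete_bipartite r s t) G"
      define D where "D y = card (link G y)" for y
      define T where "T y = card (disjoint_tuples t (link G y))" for y
      have finG: "finite (verts G)" using G by (simp add: r_graph_def)
      have vertex: "real (D y) ^ b \<le> \<theta> ^ b + 2 ^ t / \<theta> ^ (t - b) * real (T y)" for y
      proof (cases "real (D y) \<le> \<theta>")
        case True
        then have "real (D y) ^ b \<le> \<theta> ^ b" by (rule power_mono) simp
        then show ?thesis using \<theta> by (simp add: add_increasing2)
      next
        case False
        have "real (2 * t * k * n ^ (k - 1)) \<le> real (D y)"
          using elim(1) False by (simp add: \<theta>_def)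
        then have "2 * t * k * n ^ (k - 1) \<le> D y" by (simp only: of_nat_le_iff)
        then have "D y ^ t \<le> 2 ^ t * T y"
          using card_disjoint_tuples_ge[OF finG link_subset[OF G], of t y t] k n
          by (simp add: D_def T_def k_def)
        then have "real (D y ^ t) \<le> real (2 ^ t * T y)" by (simp only: of_nat_le_iff)
        then have DT: "real (D y) ^ t \<le> 2 ^ t * real (T y)" by simp
        have "real (D y) ^ b * \<theta> ^ (t - b) \<le> real (D y) ^ b * real (D y) ^ (t - b)"
          using False \<theta> by (intro mult_left_mono power_mono) auto
        also have "\<dots> = real (D y) ^ t" using assms(3) by (simp flip: power_add)
        also note DT
        finally have "real (D y) ^ b \<le> 2 ^ t / \<theta> ^ (t - b) * real (T y)"
          using \<theta> by (simp add: field_simps)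
        then show ?thesis using \<theta> by (simp add: add_increasing)
      qed
      have "real (card (copies (complete_bipartite r 1 b) G)) \<le> (\<Sum>y\<in>verts G. real (D y) ^ b)"
        using card_star_copies_le[OF G _ assms(2)] assms(1)
        by (simp add: D_def flip: of_nat_power of_nat_sum)
      also have "\<dots> \<le> (\<Sum>y\<in>verts G. \<theta> ^ b + 2 ^ t / \<theta> ^ (t - b) * real (T y))"
        by (intro sum_mono vertex)
      also have "\<dots> = real n * \<theta> ^ b + 2 ^ t / \<theta> ^ (t - b) * real (\<Sum>y\<in>verts G. T y)"
        by (simp add: sum.distrib n sum_distrib_left)
      also have "\<dots> \<le> real n * \<theta> ^ b + 2 ^ t / \<theta> ^ (t - b) * real ((n ^ k) ^ t * s)"
      proof -
        have "(\<Sum>y\<in>verts G. T y) \<le> (n ^ k) ^ t * s"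
          using sum_disjoint_tuples_le[OF G _ assms(4) _ free] assms n by (simp add: T_def k_def)
        then have "real (\<Sum>y\<in>verts G. T y) \<le> real ((n ^ k) ^ t * s)" by (simp only: of_nat_le_iff)
        then show ?thesis using \<theta> by (intro add_left_mono mult_left_mono) auto
      qed
      also have "real n * \<theta> ^ b = real n powr (1 + real b * (real r - 1) - real b / real t)"
      proof -
        have "\<theta> ^ b = real n powr ((real k - 1 / real t) * real b)"
          using elim(2) by (simp add: \<theta>_def powr_powr flip: powr_realpow)
        then have "real n * \<theta> ^ b = real n powr (1 + (real k - 1 / real t) * real b)"
          using elim(2) by (simp add: powr_add)
        then show ?thesis by (simp add: k algebra_simps)
      qed
      also have "2 ^ t / \<theta> ^ (t - b) * real ((n ^ k) ^ t * s)
          = 2 ^ t * real s * real n powr (1 + real b * (real r - 1) - real b / real t)"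
      proof -
        have 1: "\<theta> ^ (t - b) = real n powr ((real k - 1 / real t) * (real t - real b))"
          using elim(2) assms(3) by (simp add: \<theta>_def powr_powr of_nat_diff flip: powr_realpow)
        have 2: "real ((n ^ k) ^ t) = real n powr (real k * real t)"
          using elim(2) by (simp add: powr_realpow flip: power_mult of_nat_mult)
        have "real ((n ^ k) ^ t) / \<theta> ^ (t - b)
            = real n powr (real k * real t - (real k - 1 / real t) * (real t - real b))"
          unfolding 1 2 by (simp add: powr_diff)
        also have "real k * real t - (real k - 1 / real t) * (real t - real b)
            = 1 + real b * (real r - 1) - real b / real t"
        proof -
          \<comment> \<open>With the reciprocal named, the leading 1 of the exponent appears as
            \<open>u * real t\<close>.\<close>
          define u where "u = 1 / real t"
          have u: "u * real t = 1" "real b / real t = real b * u"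
            using assms(3) by (simp_all add: u_def)
          have "real k * real t - (real k - u) * (real t - real b) = u * real t + real b * real k - real b * u"
            by (simp add: algebra_simps)
          then show ?thesis unfolding u(1) u(2) k(2)[symmetric] by (simp add: u_def)
        qed
        finally have "real ((n ^ k) ^ t) / \<theta> ^ (t - b)
            = real n powr (1 + real b * (real r - 1) - real b / real t)" .
        moreover have "2 ^ t / \<theta> ^ (t - b) * real ((n ^ k) ^ t * s)
            = 2 ^ t * real s * (real ((n ^ k) ^ t) / \<theta> ^ (t - b))" by simp
        ultimately show ?thesis by (simp only:)
      qed
      finally show "real (card (copies (complete_bipartite r 1 b) G))
        \<le> (1 + 2 ^ t * real s) * real n powr (1 + real b * (real r - 1) - real b / real t)"
        by (simp add: algebra_simps)
    qed
  qed
qed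

text \<open>Vertices of degree \<open>D\<close> up to \<open>\<theta>\<close> carry at most half of
  the assumed number of edges. For the others \<open>D \<le> D ^ b / \<theta> ^ (b - 1)\<close>
  turns the remaining sum of degrees into disjoint \<open>b\<close>-tuples, hence into
  stars.\<close>

lemma eventually_copies_ge:
  fixes r t b :: nat and c :: real
  assumes "r \<ge> 2" "0 < b" "t \<ge> 2" "c > 0"
  shows "\<exists>c'>0. eventually (\<lambda>n. \<forall>G :: 'a hypergraph. r_graph r G \<and> card (verts G) = n \<and>
      c * real n powr (real r - 1 / real t) \<le> real (card (edges G)) \<longrightarrow>
      c' * real n powr (1 + real b * (real r - 1) - real b / real t)
        \<le> real (card (copies (complete_bipartite r 1 b) G))) sequentially"
proof -
  define k where "k = r - 1"
  have k: "k \<ge> 1" "real k = real r - 1" using assms(1) by (simp_all add: k_def)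
  define M where "M = (b * (r - 1) + 1) * (2 ^ (b * (r - 1) + 1)) ^ b"
  have M: "M > 0" by (simp add: M_def)
  \<comment> \<open>\<open>(c / 2) ^ b\<close> comes from \<open>\<theta> ^ b\<close>,
    \<open>2 ^ b\<close> from the greedy choice, and \<open>M\<close> from the pairs giving the same
    star.\<close>
  define c' where "c' = (c / 2) ^ b / 2 ^ b / real M"
  have c': "c' > 0" using M assms(4) by (simp add: c'_def)
  have "eventually (\<lambda>n. (2 * real b * real k) * real n ^ (k - 1) \<le> (c / 2) * real n powr (real k - 1 / real t)) sequentially"
    using assms k by (intro eventually_degree_threshold) auto
  moreover have "eventually (\<lambda>n. n > 0) sequentially" by (rule eventually_gt_at_top)
  ultimately have "eventually (\<lambda>n. \<forall>G :: 'a hypergraph. r_graph r G \<and> card (verts G) = n \<and>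
      c * real n powr (real r - 1 / real t) \<le> real (card (edges G)) \<longrightarrow>
      c' * real n powr (1 + real b * (real r - 1) - real b / real t)
        \<le> real (card (copies (complete_bipartite r 1 b) G))) sequentially"
  proof eventually_elim
    case (elim n)
    define \<theta> where "\<theta> = (c / 2) * real n powr (real k - 1 / real t)"
    have \<theta>: "\<theta> > 0" using elim(2) assms(4) by (simp add: \<theta>_def)
    show ?case
    proof (intro allI impI, elim conjE)
      fix G :: "'a hypergraph"
      assume G: "r_graph r G" and n: "card (verts G) = n"
        and many: "c * real n powr (real r - 1 / real t) \<le> real (card (edges G))"
      define D where "D y = card (link G y)" for y
      define T where "T y = card (disjoint_tuples b (link G y))" for y
      have finG: "finite (verts G)" using G by (simp add: r_graph_def)
      have vertex: "real (D y) \<le> \<theta> + 2 ^ b / \<theta> ^ (b - 1) * real (T y)" for y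
      proof (cases "real (D y) \<le> \<theta>")
        case True
        then show ?thesis using \<theta> by (simp add: add_increasing2)
      next
        case False
        have "real (2 * b * k * n ^ (k - 1)) \<le> real (D y)"
          using elim(1) False by (simp add: \<theta>_def)
        then have "2 * b * k * n ^ (k - 1) \<le> D y" by (simp only: of_nat_le_iff)
        then have "D y ^ b \<le> 2 ^ b * T y"
          using card_disjoint_tuples_ge[OF finG link_subset[OF G], of b y b] k n
          by (simp add: D_def T_def k_def)
        then have "real (D y ^ b) \<le> real (2 ^ b * T y)" by (simp only: of_nat_le_iff)
        then have DT: "real (D y) ^ b \<le> 2 ^ b * real (T y)" by simp
        have "real (D y) * \<theta> ^ (b - 1) \<le> real (D y) * real (D y) ^ (b - 1)"
          using False \<theta> by (intro mult_left_mono power_mono) auto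
        also have "\<dots> = real (D y) ^ b" using assms(2) by (simp flip: power_Suc)
        also note DT
        finally have "real (D y) \<le> 2 ^ b / \<theta> ^ (b - 1) * real (T y)"
          using \<theta> by (simp add: field_simps)
        then show ?thesis using \<theta> by simp
      qed
      \<comment> \<open>The assumed edge bound equals twice \<open>real n * \<theta>\<close>; one
        half absorbs the low-degree contribution.\<close>
      have "real n * \<theta> + real n * \<theta> = c * real n powr (1 + (real k - 1 / real t))"
        unfolding \<theta>_def powr_add using elim(2) by (simp add: field_simps)
      also have "\<dots> = c * real n powr (real r - 1 / real t)" by (simp add: k)
      also note many
      also have "real (card (edges G)) \<le> (\<Sum>y\<in>verts G. real (D y))"
        using card_edges_le_sum_links[OF G] assms(1) by (simp add: D_def flip: of_nat_sum)
      also have "\<dots> \<le> (\<Sum>y\<in>verts G. \<theta> + 2 ^ b / \<theta> ^ (b - 1) * real (T y))"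
        by (intro sum_mono vertex)
      also have "\<dots> = real n * \<theta> + 2 ^ b / \<theta> ^ (b - 1) * real (\<Sum>y\<in>verts G. T y)"
        by (simp add: sum.distrib n sum_distrib_left)
      finally have "real n * \<theta> \<le> 2 ^ b / \<theta> ^ (b - 1) * real (\<Sum>y\<in>verts G. T y)" by linarith
      then have "real n * \<theta> * \<theta> ^ (b - 1)
          \<le> 2 ^ b / \<theta> ^ (b - 1) * real (\<Sum>y\<in>verts G. T y) * \<theta> ^ (b - 1)"
        using \<theta> by (intro mult_right_mono) auto
      then have "real n * (\<theta> * \<theta> ^ (b - 1)) \<le> 2 ^ b * real (\<Sum>y\<in>verts G. T y)"
        using \<theta> by (simp add: mult.assoc)
      also have "\<theta> * \<theta> ^ (b - 1) = \<theta> ^ b" using assms(2) by (simp flip: power_Suc)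
      also have "real (\<Sum>y\<in>verts G. T y) \<le> real (card (copies (complete_bipartite r 1 b) G) * M)"
        unfolding of_nat_le_iff T_def M_def using card_star_copies_ge[OF G _ assms(2)] assms(1) by simp
      finally have "real n * \<theta> ^ b / 2 ^ b / real M \<le> real (card (copies (complete_bipartite r 1 b) G))"
        using M by (simp add: field_simps)
      moreover have "real n * \<theta> ^ b = (c / 2) ^ b * real n powr (1 + real b * (real r - 1) - real b / real t)"
      proof -
        have "\<theta> ^ b = (c / 2) ^ b * real n powr ((real k - 1 / real t) * real b)"
          unfolding \<theta>_def power_mult_distrib
          using elim(2) by (simp add: powr_powr flip: powr_realpow)
        then have "real n * \<theta> ^ b = (c / 2) ^ b * real n powr (1 + (real k - 1 / real t) * real b)"
          using elim(2) by (simp add: powr_add)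
        then show ?thesis by (simp add: k algebra_simps)
      qed
      ultimately show "c' * real n powr (1 + real b * (real r - 1) - real b / real t)
        \<le> real (card (copies (complete_bipartite r 1 b) G))"
        by (simp add: c'_def)
    qed
  qed
  then show ?thesis using c' by blast
qed

text \<open>The upper estimate holds for every admissible host and so passes to the maximum; for the
  lower one a single dense host suffices. The conditions \<open>0 < b\<close> and
  \<open>b < t\<close> force \<open>t \<ge> 2\<close>, as the degree threshold requires.\<close>

theorem theorem1p5:
  fixes r t :: nat
  assumes "r \<ge> 3" and "t > 0"
  shows "\<exists>c :: nat. \<forall>s a b :: nat. s > 0 \<and> s \<ge> c \<and> a = 1 \<and> b > 0 \<and> b < t \<longrightarrow>
    (\<lambda>n. real (ex_count r n (complete_bipartite r a b) (complete_bipartite r s t)))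
      \<in> \<Theta>(\<lambda>n. real n powr (real a + real b * (real r - 1) - real a * real b / real t))"
proof (intro exI[of _ "(t * r) ^ t + 1"] allI impI, elim conjE)
  \<comment> \<open>The witness makes \<open>s\<close> exceed the number \<open>(t * r) ^ t\<close>
    of common solutions in the algebraic construction.\<close>
  fix s a b :: nat
  assume s: "s > 0" "s \<ge> (t * r) ^ t + 1" and a: "a = 1" and b: "b > 0" "b < t"
  define C where "C n = {card (copies (complete_bipartite r 1 b) G) | G :: nat hypergraph.
            r_graph r G \<and> card (verts G) = n \<and> free_of (complete_bipartite r s t) G}" for n
  define e where "e = 1 + real b * (real r - 1) - real b / real t"
  have ex: "ex_count r n (complete_bipartite r 1 b) (complete_bipartite r s t) = Max (C n)" for n
    by (simp add: ex_count_def C_def)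
  have fin: "finite (C n)" for n unfolding C_def by (rule ex_count_set_finite)
  have "block r 0 \<union> {Inr 0} \<in> edges (complete_bipartite r s t)"
    using s(1) assms(2) unfolding complete_bipartite_def hypergraph.sel by blast
  then have ne: "C n \<noteq> {}" for n
    unfolding C_def by (intro ex_count_set_nonempty) blast
  have "eventually (\<lambda>n. \<forall>G :: nat hypergraph. r_graph r G \<and> card (verts G) = n \<and>
      free_of (complete_bipartite r s t) G \<longrightarrow>
      real (card (copies (complete_bipartite r 1 b) G))
        \<le> (1 + 2 ^ t * real s) * real n powr e) sequentially"
    unfolding e_def using assms(1) s(1) b by (intro eventually_copies_le) auto
  then have "eventually (\<lambda>n. real (Max (C n)) \<le> (1 + 2 ^ t * real s) * real n powr e) sequentially"
  proof eventually_elim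
    case (elim n)
    have "Max (C n) \<in> C n" using fin ne by (rule Max_in)
    then show ?case using elim by (auto simp: C_def)
  qed
  then have upper: "(\<lambda>n. real (Max (C n))) \<in> O(\<lambda>n. real n powr e)"
    by (intro bigoI[of _ "1 + 2 ^ t * real s"]) simp
  obtain c where c: "c > 0" "eventually (\<lambda>n. \<exists>H :: nat hypergraph. r_graph r H \<and> card (verts H) = n \<and>
    free_of (complete_bipartite r s t) H \<and>
    c * real n powr (real r - 1 / real t) \<le> real (card (edges H))) sequentially"
    using many_edges_free[of r t s] assms s by auto
  obtain c' where c': "c' > 0" "eventually (\<lambda>n. \<forall>G :: nat hypergraph. r_graph r G \<and> card (verts G) = n \<and>
      c * real n powr (real r - 1 / real t) \<le> real (card (edges G)) \<longrightarrow>
      c' * real n powr e \<le> real (card (copies (complete_bipartite r 1 b) G))) sequentially"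
    using eventually_copies_ge[where ?'a = nat, of r b t c] assms b c(1) unfolding e_def by auto
  have "eventually (\<lambda>n. c' * real n powr e \<le> real (Max (C n))) sequentially"
    using c(2) c'(2)
  proof eventually_elim
    case (elim n)
    then obtain H :: "nat hypergraph" where H: "r_graph r H" "card (verts H) = n"
      "free_of (complete_bipartite r s t) H"
      "c' * real n powr e \<le> real (card (copies (complete_bipartite r 1 b) H))" by blast
    then have "card (copies (complete_bipartite r 1 b) H) \<le> Max (C n)"
      using fin by (intro Max_ge) (auto simp: C_def)
    then show ?case using H(4) by linarith
  qed
  then have lower: "(\<lambda>n. real (Max (C n))) \<in> \<Omega>(\<lambda>n. real n powr e)"
    using c'(1) by (intro landau_omega.bigI[of c']) simp_all
  show "(\<lambda>n. real (ex_count r n (complete_bipartite r a b) (complete_bipartite r s t)))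
      \<in> \<Theta>(\<lambda>n. real n powr (real a + real b * (real r - 1) - real a * real b / real t))"
    using bigthetaI[OF upper lower] by (simp add: a ex[simplified] e_def)
qed

end
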